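(* Let $\Delta$ be a flag simplicial complex. Then $\Delta$ is an obstruction to shellability if and only if $\Delta$ is isomorphic to the independence complex $I(C_n)$ of the $n$-cycle for some $n=4$ or $n\geq 6$.
   Context: A flag complex is a simplicial complex in which every set of vertices that are pairwise joined by edges is a face; equivalently, it is the independence complex $I(G)$ of some graph $G$ (the simplicial complex on $V(G)$ whose faces are the independent sets of $G$). An obstruction to shellability is a non-shellable simplicial complex all of whose proper induced subcomplexes (subcomplexes consisting of all faces contained in a proper subset of the vertex set) are shellable. $C_n$ denotes the cycle graph on $n$ vertices. *)

theory Defs
  imports Main
begin

text \<open>
  Finite abstract simplicial complexes are given by their set of faces; the vertex set is the
  union of the faces, so every vertex spans a face. The void complex (no faces) is excluded,
  the complex whose only face is the empty set is not.
\<close>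

definition abstract_complex :: "'a set set \<Rightarrow> bool" where
  "abstract_complex \<Delta> \<longleftrightarrow>
     finite \<Delta> \<and> \<Delta> \<noteq> {} \<and> (\<forall>F\<in>\<Delta>. finite F \<and> (\<forall>G. G \<subseteq> F \<longrightarrow> G \<in> \<Delta>))"

definition complex_verts :: "'a set set \<Rightarrow> 'a set" where
  "complex_verts \<Delta> = \<Union>\<Delta>"

definition flag_complex :: "'a set set \<Rightarrow> bool" where
  "flag_complex \<Delta> \<longleftrightarrow>
     abstract_complex \<Delta> \<and>
     (\<forall>S. S \<subseteq> complex_verts \<Delta> \<longrightarrow>
        (\<forall>u\<in>S. \<forall>v\<in>S. u \<noteq> v \<longrightarrow> {u, v} \<in> \<Delta>) \<longrightarrow> S \<in> \<Delta>)"

definition complex_isomorphic :: "'a set set \<Rightarrow> 'b set set \<Rightarrow> bool" where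
  "complex_isomorphic \<Delta> \<Gamma> \<longleftrightarrow>
     (\<exists>f. bij_betw f (complex_verts \<Delta>) (complex_verts \<Gamma>) \<and> (\<lambda>F. f ` F) ` \<Delta> = \<Gamma>)"

definition induced_subcomplex :: "'a set set \<Rightarrow> 'a set \<Rightarrow> 'a set set" where
  "induced_subcomplex \<Delta> W = {F \<in> \<Delta>. F \<subseteq> W}"

definition complex_facets :: "'a set set \<Rightarrow> 'a set set" where
  "complex_facets \<Delta> = {F \<in> \<Delta>. \<forall>G\<in>\<Delta>. F \<subseteq> G \<longrightarrow> G = F}"

text \<open>Dimensions are integers because the empty face has dimension -1.\<close>

definition face_dim :: "'a set \<Rightarrow> int" where
  "face_dim F = int (card F) - 1"

definition pure_of_dim :: "'a set set \<Rightarrow> int \<Rightarrow> bool" where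
  "pure_of_dim \<Delta> d \<longleftrightarrow> \<Delta> \<noteq> {} \<and> (\<forall>F\<in>complex_facets \<Delta>. face_dim F = d)"

text \<open>
  Shellability in the nonpure sense of Bjoerner and Wachs: the facets may have different
  dimensions. The simplex spanned by a facet \<open>F\<close> is \<open>Pow F\<close>.
\<close>

definition shelling :: "'a set set \<Rightarrow> 'a set list \<Rightarrow> bool" where
  "shelling \<Delta> Fs \<longleftrightarrow>
     distinct Fs \<and> set Fs = complex_facets \<Delta> \<and>
     (\<forall>k. 0 < k \<and> k < length Fs \<longrightarrow>
        pure_of_dim ((\<Union>j<k. Pow (Fs ! j)) \<inter> Pow (Fs ! k)) (face_dim (Fs ! k) - 1))"

definition shellable :: "'a set set \<Rightarrow> bool" where
  "shellable \<Delta> \<longleftrightarrow> (\<exists>Fs. shelling \<Delta> Fs)"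

definition obstruction_to_shellability :: "'a set set \<Rightarrow> bool" where
  "obstruction_to_shellability \<Delta> \<longleftrightarrow>
     abstract_complex \<Delta> \<and> \<not> shellable \<Delta> \<and>
     (\<forall>W. W \<subset> complex_verts \<Delta> \<longrightarrow> shellable (induced_subcomplex \<Delta> W))"

text \<open>A graph is a pair of its vertex set and its set of edges, each edge being a two-element set.\<close>

type_synonym 'a graph = "'a set \<times> 'a set set"

definition independent_set :: "'a graph \<Rightarrow> 'a set \<Rightarrow> bool" where
  "independent_set G S \<longleftrightarrow> S \<subseteq> fst G \<and> (\<forall>u\<in>S. \<forall>v\<in>S. {u, v} \<notin> snd G)"

definition independence_complex :: "'a graph \<Rightarrow> 'a set set" where
  "independence_complex G = {S. independent_set G S}"

text \<open>This is the cycle graph only for \<open>n \<ge> 3\<close>; smaller \<open>n\<close> give degenerate values.\<close>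

definition cycle_graph :: "nat \<Rightarrow> nat graph" where
  "cycle_graph n = ({..<n}, {{i, Suc i mod n} | i. i < n})"

end

theory Submission
  imports Defs
begin

text \<open>
  A flag complex is the complex of stable sets of its graph of non-edges. If \<open>v\<close> is a shedding
  vertex of a graph, shellings of the deletion of \<open>v\<close> and of the link of \<open>v\<close> concatenate, so an
  obstruction has no shedding vertex. A graph with an edge but without induced cycles of length
  4 or at least 6 has one: if it contains an induced path on three vertices, it contains such a
  path that is not the middle of an induced path on five vertices, and the midpoint of that path
  is shedding. Conversely the cycles of these lengths are not shellable, which is seen on the
  stable sets \<open>{j, j + 2, j + 4, \<dots>}\<close> of size \<open>n div 2\<close>, while a proper subset of a cycle induces
  disjoint paths.
\<close>

section \<open>Shellings and shedding vertices\<close>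

text \<open>The search for a shedding vertex parallels Dirac's theorem that a chordal graph has a
  simplicial vertex, with a three-vertex path in the role of the vertex. Length five has to stay
  allowed throughout, since the complex of the 5-cycle is again a pentagon and shellable. The two
  forbidden kinds of cycle therefore enter separately: a path that cannot be extended at both ends
  exists as soon as no induced cycle has length at least 6, and 4-cycles are excluded only when its
  midpoint is shown to be shedding. The bound 6 counts the five vertices of an extended path plus at
  least one more that closes it up.

  In the converse, the facets of a cycle's complex have different sizes in general, and describing
  all of them would be awkward. It is enough to know which facets contain a stable set of size
  \<open>n div 2\<close> with one vertex removed: these are again of that size, and there are very
  few of them.\<close>

lemma face_in_facet:
  assumes "finite \<Delta>" "S \<in> \<Delta>"
  obtains F where "F \<in> complex_facets \<Delta>" "S \<subseteq> F"
proof -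
  obtain F where "F \<in> \<Delta>" "S \<subseteq> F" "\<forall>G\<in>\<Delta>. F \<subseteq> G \<longrightarrow> F = G"
    using finite_has_maximal2[OF assms] by blast
  then show ?thesis
    using that[of F] by (auto simp: complex_facets_def)
qed

lemma facets_antichain:
  "F \<in> complex_facets \<Delta> \<Longrightarrow> G \<in> complex_facets \<Delta> \<Longrightarrow> F \<subseteq> G \<Longrightarrow> F = G"
  by (auto simp: complex_facets_def)

lemma facets_subcomplex:
  "T \<in> complex_facets \<Delta> \<Longrightarrow> \<Gamma> \<subseteq> \<Delta> \<Longrightarrow> T \<in> \<Gamma> \<Longrightarrow> T \<in> complex_facets \<Gamma>"
  by (auto simp: complex_facets_def)

text \<open>A facet of the intersection that contains \<open>A \<inter> F\<close> misses exactly one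
  vertex of \<open>F\<close>, and this is the required \<open>x\<close>. Conversely every facet of
  the intersection lies in some \<open>A\<close>, hence in a set \<open>F - {x}\<close> that is
  itself a face of the intersection.\<close>

lemma pure_intersection_iff:
  assumes fin: "finite F" and ne: "\<A> \<noteq> {}" and nsub: "\<And>A. A \<in> \<A> \<Longrightarrow> \<not> F \<subseteq> A"
  shows "pure_of_dim ((\<Union>A\<in>\<A>. Pow A) \<inter> Pow F) (face_dim F - 1) \<longleftrightarrow>
         (\<forall>A\<in>\<A>. \<exists>x\<in>F - A. \<exists>B\<in>\<A>. F - {x} \<subseteq> B)"
    (is "pure_of_dim ?K _ \<longleftrightarrow> ?R")
proof
  assume pure: "pure_of_dim ?K (face_dim F - 1)"
  show ?R
  proof
    fix A assume A: "A \<in> \<A>"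
    have "finite ?K" using fin by simp
    moreover have "A \<inter> F \<in> ?K" using A by blast
    ultimately obtain H where H: "H \<in> complex_facets ?K" "A \<inter> F \<subseteq> H"
      by (rule face_in_facet)
    have HF: "H \<subseteq> F" and HK: "\<exists>B\<in>\<A>. H \<subseteq> B"
      using H(1) by (auto simp: complex_facets_def)
    have "int (card H) = int (card F) - 1"
      using pure H(1) by (auto simp: pure_of_dim_def face_dim_def)
    then have "card (F - H) = 1"
      using card_Diff_subset[of H F] HF fin finite_subset by fastforce
    then obtain x where "F - H = {x}" by (rule card_1_singletonE)
    then have "x \<in> F - A" "F - {x} = H" using HF H(2) by auto
    then show "\<exists>x\<in>F - A. \<exists>B\<in>\<A>. F - {x} \<subseteq> B" using HK by blast
  qed
next
  assume R: ?R
  show "pure_of_dim ?K (face_dim F - 1)"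
    unfolding pure_of_dim_def
  proof (intro conjI ballI)
    show "?K \<noteq> {}" using ne by blast
    fix H assume H: "H \<in> complex_facets ?K"
    then obtain A where A: "A \<in> \<A>" "H \<subseteq> A" "H \<subseteq> F"
      by (auto simp: complex_facets_def)
    then obtain x B where x: "x \<in> F - A" "B \<in> \<A>" "F - {x} \<subseteq> B"
      using R by blast
    have "F - {x} \<in> ?K" using x by auto
    moreover have "H \<subseteq> F - {x}" using A x by blast
    ultimately have "H = F - {x}"
      using H by (auto simp: complex_facets_def)
    moreover have "card F > 0" using x fin by (auto simp: card_gt_0_iff)
    ultimately show "face_dim H = face_dim F - 1"
      using x by (simp add: face_dim_def of_nat_diff)
  qed
qed

text \<open>The usual pairwise criterion for shellings. It is free of dimensions, so it fits the
  nonpure case as it stands; \<open>k = 0\<close> is vacuous.\<close>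

definition exchange_order :: "'a set list \<Rightarrow> bool" where
  "exchange_order Fs \<longleftrightarrow>
     (\<forall>k<length Fs. \<forall>j<k. \<exists>x\<in>Fs ! k - Fs ! j. \<exists>i<k. Fs ! k - {x} \<subseteq> Fs ! i)"

lemma shelling_iff_exchange_order:
  assumes fin: "\<And>F. F \<in> \<Delta> \<Longrightarrow> finite F"
  shows "shelling \<Delta> Fs \<longleftrightarrow>
         distinct Fs \<and> set Fs = complex_facets \<Delta> \<and> exchange_order Fs"
proof -
  have *: "pure_of_dim ((\<Union>j<k. Pow (Fs ! j)) \<inter> Pow (Fs ! k)) (face_dim (Fs ! k) - 1) \<longleftrightarrow>
      (\<forall>j<k. \<exists>x\<in>Fs ! k - Fs ! j. \<exists>i<k. Fs ! k - {x} \<subseteq> Fs ! i)"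
    if d: "distinct Fs" and s: "set Fs = complex_facets \<Delta>" and k: "0 < k" "k < length Fs" for k
  proof -
    have facet: "Fs ! j \<in> complex_facets \<Delta>" if "j < length Fs" for j
      using s that nth_mem by blast
    have "finite (Fs ! k)"
      using facet[OF k(2)] fin by (auto simp: complex_facets_def)
    moreover have "\<not> Fs ! k \<subseteq> A" if "A \<in> (!) Fs ` {..<k}" for A
    proof
      assume "Fs ! k \<subseteq> A"
      obtain j where j: "j < k" "A = Fs ! j" using \<open>A \<in> (!) Fs ` {..<k}\<close> by auto
      then have "Fs ! k = Fs ! j"
        using facets_antichain[OF facet facet] \<open>Fs ! k \<subseteq> A\<close> k by simp
      then show False using d j k by (simp add: nth_eq_iff_index_eq)
    qed
    ultimately show ?thesis
      using pure_intersection_iff[of "Fs ! k" "(!) Fs ` {..<k}"] k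
      by (auto simp: image_image Ball_def Bex_def lessThan_empty_iff)
  qed
  have "(\<forall>k. 0 < k \<and> k < length Fs \<longrightarrow>
        pure_of_dim ((\<Union>j<k. Pow (Fs ! j)) \<inter> Pow (Fs ! k)) (face_dim (Fs ! k) - 1)) \<longleftrightarrow>
      exchange_order Fs" if "distinct Fs" "set Fs = complex_facets \<Delta>"
    unfolding exchange_order_def using *[OF that] by (metis gr_implies_not0 neq0_conv)
  then show ?thesis unfolding shelling_def by blast
qed

text \<open>List positions become an injective rank, so that the last facet of a family can be
  chosen without handling indices.\<close>

lemma shellable_rank:
  assumes "shellable \<Delta>" and fin: "\<And>F. F \<in> \<Delta> \<Longrightarrow> finite F"
  obtains r :: "'a set \<Rightarrow> nat" where "inj_on r (complex_facets \<Delta>)"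
    "\<And>F G. \<lbrakk>F \<in> complex_facets \<Delta>; G \<in> complex_facets \<Delta>; r G < r F\<rbrakk> \<Longrightarrow>
       \<exists>x\<in>F - G. \<exists>A\<in>complex_facets \<Delta>. r A < r F \<and> F - {x} \<subseteq> A"
proof -
  obtain Fs where Fs: "distinct Fs" "set Fs = complex_facets \<Delta>" "exchange_order Fs"
    using assms(1) shelling_iff_exchange_order[OF fin] by (auto simp: shellable_def)
  have "\<forall>F\<in>complex_facets \<Delta>. \<exists>k. k < length Fs \<and> Fs ! k = F"
    using Fs(2) by (metis in_set_conv_nth)
  then obtain r where r: "\<And>F. F \<in> complex_facets \<Delta> \<Longrightarrow> r F < length Fs \<and> Fs ! r F = F"
    by metis
  have "inj_on r (complex_facets \<Delta>)"
    by (rule inj_onI) (metis r)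
  moreover have "\<exists>x\<in>F - G. \<exists>A\<in>complex_facets \<Delta>. r A < r F \<and> F - {x} \<subseteq> A"
    if FG: "F \<in> complex_facets \<Delta>" "G \<in> complex_facets \<Delta>" "r G < r F" for F G
  proof -
    obtain x i where xi: "x \<in> F - G" "i < r F" "F - {x} \<subseteq> Fs ! i"
      using Fs(3) r[OF FG(1)] r[OF FG(2)] FG(3) unfolding exchange_order_def by metis
    have "i < length Fs" using xi(2) r[OF FG(1)] by simp
    then have A: "Fs ! i \<in> complex_facets \<Delta>" using Fs(2) nth_mem by blast
    have "r (Fs ! i) = i"
      using r[OF A] nth_eq_iff_index_eq[OF Fs(1) _ \<open>i < length Fs\<close>] by blast
    then show ?thesis using xi A by (intro bexI[of _ x] bexI[of _ "Fs ! i"] conjI) simp_all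
  qed
  ultimately show ?thesis using that by blast
qed

text \<open>The vertex set is a parameter beside a fixed relation, so that deletion, link and
  induced subcomplex are all stable-set complexes of the same \<open>E\<close> on smaller
  sets.\<close>

definition stable_sets :: "('a \<Rightarrow> 'a \<Rightarrow> bool) \<Rightarrow> 'a set \<Rightarrow> 'a set set" where
  "stable_sets E W = {S. S \<subseteq> W \<and> (\<forall>u\<in>S. \<forall>v\<in>S. \<not> E u v)}"

lemma stable_sets_mono: "U \<subseteq> W \<Longrightarrow> stable_sets E U \<subseteq> stable_sets E W"
  by (auto simp: stable_sets_def)

lemma stable_subset: "S \<in> stable_sets E W \<Longrightarrow> T \<subseteq> S \<Longrightarrow> T \<in> stable_sets E W"
  unfolding stable_sets_def by blast

lemma finite_stable_sets: "finite W \<Longrightarrow> finite (stable_sets E W)"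
  by (rule finite_subset[of _ "Pow W"]) (auto simp: stable_sets_def)

lemma finite_stable_set: "finite W \<Longrightarrow> S \<in> stable_sets E W \<Longrightarrow> finite S"
  by (auto simp: stable_sets_def intro: finite_subset)

lemma shellable_edgeless:
  assumes "finite W" "\<And>u v. u \<in> W \<Longrightarrow> v \<in> W \<Longrightarrow> \<not> E u v"
  shows "shellable (stable_sets E W)"
proof -
  have "stable_sets E W = Pow W" using assms(2) by (auto simp: stable_sets_def)
  then have "complex_facets (stable_sets E W) = {W}" by (auto simp: complex_facets_def)
  then have "shelling (stable_sets E W) [W]"
    by (auto simp: shelling_def)
  then show ?thesis by (auto simp: shellable_def)
qed

locale simple_graph =
  fixes E :: "'a \<Rightarrow> 'a \<Rightarrow> bool"
  assumes sym: "E u v \<Longrightarrow> E v u" and irrefl: "\<not> E u u"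
begin

text \<open>The set \<open>W - {v} - {u. E v u}\<close> carries the link of \<open>v\<close>. The
  condition amounts to saying that no facet of the link is a facet of the deletion.\<close>

definition shedding :: "'a set \<Rightarrow> 'a \<Rightarrow> bool" where
  "shedding W v \<longleftrightarrow>
     v \<in> W \<and> (\<forall>S\<in>stable_sets E (W - {v} - {u. E v u}). \<exists>w\<in>W. E v w \<and> (\<forall>s\<in>S. \<not> E w s))"

lemma stable_insert:
  "insert v S \<in> stable_sets E W \<longleftrightarrow> v \<in> W \<and> S \<in> stable_sets E W \<and> (\<forall>s\<in>S. \<not> E v s)"
  unfolding stable_sets_def using sym irrefl by blast

text \<open>Shedding matters for one inclusion: a facet of the deletion could lose maximality only
  by absorbing \<open>v\<close>. It would then be a face of the link, and some neighbour
  \<open>w\<close> of \<open>v\<close> would enlarge it inside the deletion.\<close>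

lemma facets_shedding:
  assumes "shedding W v"
  shows "complex_facets (stable_sets E W) =
           complex_facets (stable_sets E (W - {v})) \<union>
           insert v ` complex_facets (stable_sets E (W - {v} - {u. E v u}))"
    (is "_ = complex_facets ?D \<union> insert v ` complex_facets ?L")
proof (intro equalityI subsetI)
  have sub: "?D \<subseteq> stable_sets E W" "?L \<subseteq> stable_sets E W" "?L \<subseteq> ?D"
    by (intro stable_sets_mono; blast)+
  have vW: "v \<in> W" using assms by (simp add: shedding_def)
  have v_link: "insert v G \<in> stable_sets E W \<longleftrightarrow> G \<in> ?L" if "v \<notin> G" for G
    using that vW unfolding stable_insert unfolding stable_sets_def by blast
  {
    fix T assume T: "T \<in> complex_facets (stable_sets E W)"
    then have TW: "T \<in> stable_sets E W" by (simp add: complex_facets_def)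
    show "T \<in> complex_facets ?D \<union> insert v ` complex_facets ?L"
    proof (cases "v \<in> T")
      case False
      have "T \<in> ?D" using TW False by (auto simp: stable_sets_def)
      then show ?thesis using facets_subcomplex[OF T sub(1)] by blast
    next
      case True
      have "T - {v} \<in> complex_facets ?L"
        unfolding complex_facets_def
      proof (intro CollectI conjI ballI impI)
        show "T - {v} \<in> ?L"
          using v_link[of "T - {v}"] TW True by (simp add: insert_absorb)
        fix G assume G: "G \<in> ?L" "T - {v} \<subseteq> G"
        have "v \<notin> G" using G by (auto simp: stable_sets_def)
        then have "insert v G \<in> stable_sets E W" using v_link G by blast
        moreover have "T \<subseteq> insert v G" using G by blast
        ultimately have "insert v G = T" using T by (auto simp: complex_facets_def)
        then show "G = T - {v}" using \<open>v \<notin> G\<close> by blast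
      qed
      moreover have "T = insert v (T - {v})" using True by blast
      ultimately show ?thesis by blast
    qed
  next
    fix T assume "T \<in> complex_facets ?D \<union> insert v ` complex_facets ?L"
    then show "T \<in> complex_facets (stable_sets E W)"
    proof
      assume T: "T \<in> complex_facets ?D"
      then have TD: "T \<in> ?D" by (simp add: complex_facets_def)
      show ?thesis
        unfolding complex_facets_def
      proof (intro CollectI conjI ballI impI)
        show "T \<in> stable_sets E W" using TD sub by blast
        fix G assume G: "G \<in> stable_sets E W" "T \<subseteq> G"
        have "v \<notin> G"
        proof
          assume "v \<in> G"
          have "v \<notin> T" using TD by (auto simp: stable_sets_def)
          moreover have "insert v T \<in> stable_sets E W"
            using G \<open>v \<in> G\<close> by (auto intro: stable_subset)
          ultimately have "T \<in> ?L" using v_link by blast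
          then obtain w where w: "w \<in> W" "E v w" "\<forall>s\<in>T. \<not> E w s"
            using assms by (auto simp: shedding_def)
          have "w \<noteq> v" using w irrefl by blast
          then have "insert w T \<in> ?D" using w TD unfolding stable_insert by simp
          then have "insert w T = T" using T by (auto simp: complex_facets_def)
          then show False using w \<open>T \<in> ?L\<close> by (auto simp: stable_sets_def)
        qed
        then have "G \<in> ?D" using G by (auto simp: stable_sets_def)
        then show "G = T" using T G by (auto simp: complex_facets_def)
      qed
    next
      assume "T \<in> insert v ` complex_facets ?L"
      then obtain S where S: "S \<in> complex_facets ?L" and T: "T = insert v S" by blast
      have SL: "S \<in> ?L" using S by (simp add: complex_facets_def)
      then have "v \<notin> S" by (auto simp: stable_sets_def)
      show ?thesis
        unfolding complex_facets_def
      proof (intro CollectI conjI ballI impI)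
        show "T \<in> stable_sets E W" using v_link SL T \<open>v \<notin> S\<close> by blast
        fix G assume G: "G \<in> stable_sets E W" "T \<subseteq> G"
        have "insert v (G - {v}) = G" using G T by blast
        then have "G - {v} \<in> ?L" using v_link[of "G - {v}"] G by simp
        moreover have "S \<subseteq> G - {v}" using G T \<open>v \<notin> S\<close> by blast
        ultimately have "G - {v} = S" using S by (auto simp: complex_facets_def)
        then show "G = T" using G T by blast
      qed
    qed
  }
qed

lemma shellable_shedding:
  assumes fin: "finite W" and shed: "shedding W v"
    and del: "shellable (stable_sets E (W - {v}))"
    and link: "shellable (stable_sets E (W - {v} - {u. E v u}))"
  shows "shellable (stable_sets E W)"
proof -
  let ?D = "stable_sets E (W - {v})"
  let ?L = "stable_sets E (W - {v} - {u. E v u})"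
  have shelling_iff: "shelling (stable_sets E U) Ls \<longleftrightarrow>
      distinct Ls \<and> set Ls = complex_facets (stable_sets E U) \<and> exchange_order Ls"
    if "finite U" for U Ls
    using finite_stable_set[OF that] by (rule shelling_iff_exchange_order)
  obtain Fs where Fs: "distinct Fs" "set Fs = complex_facets ?D" "exchange_order Fs"
    using del shelling_iff[of "W - {v}"] fin by (auto simp: shellable_def)
  obtain Gs where Gs: "distinct Gs" "set Gs = complex_facets ?L" "exchange_order Gs"
    using link shelling_iff[of "W - {v} - {u. E v u}"] fin by (auto simp: shellable_def)
  let ?Hs = "Fs @ map (insert v) Gs"
  have vF: "v \<notin> F" if "F \<in> set Fs" for F
    using that Fs(2) by (auto simp: complex_facets_def stable_sets_def)
  have vG: "v \<notin> G" if "G \<in> set Gs" for G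
    using that Gs(2) by (auto simp: complex_facets_def stable_sets_def)
  have "inj_on (insert v) (set Gs)"
    by (rule inj_onI) (use vG in \<open>metis insert_ident\<close>)
  then have "distinct ?Hs" using Fs(1) Gs(1) vF by (auto simp: distinct_map)
  moreover have "set ?Hs = complex_facets (stable_sets E W)"
    using facets_shedding[OF shed] Fs(2) Gs(2) by simp
  moreover have "exchange_order ?Hs"
    unfolding exchange_order_def
  proof (intro allI impI)
    fix k j assume k: "k < length ?Hs" and j: "j < k"
    show "\<exists>x\<in>?Hs ! k - ?Hs ! j. \<exists>i<k. ?Hs ! k - {x} \<subseteq> ?Hs ! i"
    proof (cases "k < length Fs")
      case True
      then obtain x i where "x \<in> Fs ! k - Fs ! j" "i < k" "Fs ! k - {x} \<subseteq> Fs ! i"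
        using Fs(3) j unfolding exchange_order_def by blast
      then show ?thesis using True j by (auto simp: nth_append intro!: bexI[of _ x] exI[of _ i])
    next
      case False
      define l where "l = k - length Fs"
      have l: "l < length Gs" "k = length Fs + l" using False k by (auto simp: l_def)
      then have Hk: "?Hs ! k = insert v (Gs ! l)" by (simp add: nth_append)
      have Gl: "Gs ! l \<in> set Gs" using l by simp
      show ?thesis
      proof (cases "j < length Fs")
        case True
        have "Gs ! l \<in> ?L" using Gl Gs(2) by (auto simp: complex_facets_def)
        then have "Gs ! l \<in> ?D" using stable_sets_mono[of "W - {v} - {u. E v u}" "W - {v}"] by blast
        then obtain F where F: "F \<in> complex_facets ?D" "Gs ! l \<subseteq> F"
          using face_in_facet[OF finite_stable_sets] fin by blast
        then obtain i where i: "i < length Fs" "F = Fs ! i"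
          using Fs(2) by (metis in_set_conv_nth)
        \<comment> \<open>For facets from different blocks the exchanged vertex is \<open>v\<close>:
          what remains is a face of the link, hence of the deletion, and lies in a facet of the
          first block.\<close>
        have "v \<in> ?Hs ! k - ?Hs ! j" using True Hk vF by (simp add: nth_append)
        moreover have "?Hs ! k - {v} \<subseteq> ?Hs ! i" using Hk F i by (auto simp: nth_append)
        moreover have "i < k" using i l by simp
        ultimately show ?thesis by blast
      next
        case False
        then obtain m where m: "j = length Fs + m" using le_Suc_ex not_less by blast
        then have "m < l" using j l by simp
        then obtain x i where xi: "x \<in> Gs ! l - Gs ! m" "i < l" "Gs ! l - {x} \<subseteq> Gs ! i"
          using Gs(3) l unfolding exchange_order_def by blast
        have "x \<noteq> v" using xi vG Gl by blast
        moreover have "?Hs ! j = insert v (Gs ! m)" "?Hs ! (length Fs + i) = insert v (Gs ! i)"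
          using m \<open>m < l\<close> xi l by (simp_all add: nth_append)
        ultimately show ?thesis
          using Hk xi l by (intro bexI[of _ x] exI[of _ "length Fs + i"]) auto
      qed
    qed
  qed
  ultimately have "shelling (stable_sets E W) ?Hs"
    using shelling_iff[OF fin] by blast
  then show ?thesis by (auto simp: shellable_def)
qed

section \<open>Induced paths and cycles\<close>

definition cycle_labelling :: "'a set \<Rightarrow> nat \<Rightarrow> (nat \<Rightarrow> 'a) \<Rightarrow> bool" where
  "cycle_labelling U n f \<longleftrightarrow>
     bij_betw f {..<n} U \<and>
     (\<forall>i<n. \<forall>j<n. E (f i) (f j) \<longleftrightarrow> j = Suc i mod n \<or> i = Suc j mod n)"

definition induced_path3 :: "'a set \<Rightarrow> 'a \<Rightarrow> 'a \<Rightarrow> 'a \<Rightarrow> bool" where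
  "induced_path3 W x y z \<longleftrightarrow> {x, y, z} \<subseteq> W \<and> x \<noteq> z \<and> E x y \<and> E y z \<and> \<not> E x z"

text \<open>Around an induced path \<open>x\<close>, \<open>y\<close>, \<open>z\<close> this yields
  an induced path \<open>a\<close>, \<open>x\<close>, \<open>y\<close>, \<open>z\<close>,
  \<open>b\<close>; distinctness of the five vertices follows from the adjacencies.\<close>

definition extendable :: "'a set \<Rightarrow> 'a \<Rightarrow> 'a \<Rightarrow> 'a \<Rightarrow> bool" where
  "extendable W x y z \<longleftrightarrow>
     (\<exists>a\<in>W. \<exists>b\<in>W. E a x \<and> \<not> E a y \<and> \<not> E a z \<and> E z b \<and> \<not> E x b \<and> \<not> E y b \<and> \<not> E a b)"

text \<open>Without induced three-vertex paths the graph on \<open>W\<close> is a disjoint union of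
  cliques, so a set avoiding \<open>u\<close> and its neighbours contains no neighbour of
  \<open>v\<close> either.\<close>

lemma edge_shedding:
  assumes "u \<in> W" "v \<in> W" "E u v" "\<And>x y z. \<not> induced_path3 W x y z"
  shows "shedding W u"
  unfolding shedding_def
proof (intro conjI ballI)
  fix S assume S: "S \<in> stable_sets E (W - {u} - {w. E u w})"
  have "\<not> E v s" if "s \<in> S" for s
    using assms(1-3) assms(4)[of u v s] S that by (auto simp: stable_sets_def induced_path3_def)
  then show "\<exists>w\<in>W. E u w \<and> (\<forall>s\<in>S. \<not> E w s)" using assms by blast
qed (fact assms)

lemma four_cycle:
  assumes "E w x" "E x y" "E y z" "E z w" "\<not> E w y" "\<not> E x z" "w \<noteq> y" "x \<noteq> z"
  shows "cycle_labelling {w, x, y, z} 4 (\<lambda>i. [w, x, y, z] ! i)"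
proof -
  have four: "i < 4 \<longleftrightarrow> i = 0 \<or> i = 1 \<or> i = 2 \<or> i = 3" for i :: nat by linarith
  have ne: "w \<noteq> x" "x \<noteq> y" "y \<noteq> z" "z \<noteq> w" using assms irrefl by metis+
  have adj: "E x w" "E y x" "E z y" "E w z" "\<not> E y w" "\<not> E z x" using assms sym by blast+
  note facts = assms adj ne ne[symmetric] assms(7,8)[symmetric] irrefl
  have inj: "inj_on (\<lambda>i. [w, x, y, z] ! i) {..<4}"
    unfolding inj_on_def Ball_def lessThan_iff four
    by (intro allI impI; elim disjE; simp add: facts)
  have adj_iff:
    "\<forall>i<4. \<forall>j<4. E ([w, x, y, z] ! i) ([w, x, y, z] ! j) \<longleftrightarrow> j = Suc i mod 4 \<or> i = Suc j mod 4"
    unfolding four by (intro allI impI; elim disjE; simp add: facts)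
  have img: "(\<lambda>i. [w, x, y, z] ! i) ` {..<4} = {w, x, y, z}"
  proof -
    have "{..<4} = {0, 1, 2, 3::nat}" by (simp add: set_eq_iff four)
    then show ?thesis by simp
  qed
  show ?thesis
    unfolding cycle_labelling_def bij_betw_def by (intro conjI inj img adj_iff)
qed

text \<open>
  A stable set avoiding \<open>y\<close> and its neighbours that blocks both \<open>x\<close> and \<open>z\<close> would close an
  induced 4-cycle or extend the path at both ends.
\<close>

lemma path3_shedding:
  assumes P: "induced_path3 W x y z" and ext: "\<not> extendable W x y z"
    and no4: "\<And>U f. U \<subseteq> W \<Longrightarrow> \<not> cycle_labelling U 4 f"
  shows "shedding W y"
  unfolding shedding_def
proof (intro conjI ballI)
  show "y \<in> W" using P by (simp add: induced_path3_def)
  have xyz: "x \<in> W" "z \<in> W" "E x y" "E y x" "E y z" "E z y" "\<not> E x z" "x \<noteq> z"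
    using P by (auto simp: induced_path3_def intro: sym)
  fix S assume S: "S \<in> stable_sets E (W - {y} - {u. E y u})"
  show "\<exists>w\<in>W. E y w \<and> (\<forall>s\<in>S. \<not> E w s)"
  proof (rule ccontr)
    assume "\<not> ?thesis"
    then obtain s t where s: "s \<in> S" "E x s" and t: "t \<in> S" "E z t"
      using xyz by meson
    have mem: "s \<in> W" "t \<in> W" "\<not> E y s" "\<not> E y t" "s \<noteq> y" "t \<noteq> y"
      using S s t by (auto simp: stable_sets_def)
    have common: False if "E x r" "E z r" "r \<in> W" "\<not> E y r" "r \<noteq> y" for r
    proof -
      have "cycle_labelling {x, y, z, r} 4 (\<lambda>i. [x, y, z, r] ! i)"
        using that xyz by (intro four_cycle) (auto intro: sym)
      then show False using no4[of "{x, y, z, r}"] that xyz \<open>y \<in> W\<close> by auto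
    qed
    have "\<not> E z s" "\<not> E x t" using common s t mem by blast+
    moreover have "\<not> E s t" using S s t by (auto simp: stable_sets_def)
    ultimately have "extendable W x y z"
      unfolding extendable_def using s t mem sym by blast
    then show False using ext by blast
  qed
qed

section \<open>Connected sets and shortest paths through them\<close>

definition connected_in :: "'a set \<Rightarrow> bool" where
  "connected_in B \<longleftrightarrow> (\<forall>x\<in>B. \<forall>y\<in>B. (x, y) \<in> {(u, v). u \<in> B \<and> v \<in> B \<and> E u v}\<^sup>*)"

lemma connected_insert:
  assumes "connected_in B" "x \<in> B" "E s x"
  shows "connected_in (insert s B)"
proof -
  let ?R = "\<lambda>B. {(u, v). u \<in> B \<and> v \<in> B \<and> E u v}"
  have mono: "(?R B)\<^sup>* \<subseteq> (?R (insert s B))\<^sup>*" by (rule rtrancl_mono) auto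
  have "(s, x) \<in> (?R (insert s B))\<^sup>*" "(x, s) \<in> (?R (insert s B))\<^sup>*"
    using assms by (auto intro!: r_into_rtrancl intro: sym)
  moreover have "(u, v) \<in> (?R (insert s B))\<^sup>*" if "u \<in> B" "v \<in> B" for u v
    using that assms(1) mono unfolding connected_in_def by blast
  ultimately show ?thesis
    using assms(2) unfolding connected_in_def
    by (metis (no_types, lifting) insertE rtrancl.rtrancl_refl rtrancl_trans)
qed

text \<open>Only a walk: repetitions and chords are allowed, and minimal length removes them
  later.\<close>

definition path_through :: "'a set \<Rightarrow> 'a \<Rightarrow> 'a \<Rightarrow> nat \<Rightarrow> (nat \<Rightarrow> 'a) \<Rightarrow> bool" where
  "path_through B a b n p \<longleftrightarrow>
     p 0 = a \<and> p n = b \<and> (\<forall>i<n. E (p i) (p (Suc i))) \<and> (\<forall>i. 0 < i \<and> i < n \<longrightarrow> p i \<in> B)"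

lemma path_through_exists:
  assumes B: "connected_in B" and ab: "x \<in> B" "E a x" "y \<in> B" "E y b"
  shows "\<exists>n p. path_through B a b n p"
proof -
  have "(x, y) \<in> {(u, v). u \<in> B \<and> v \<in> B \<and> E u v}\<^sup>*"
    using B ab by (auto simp: connected_in_def)
  then obtain m f where f: "f 0 = x" "f m = y"
    "\<forall>i<m. f i \<in> B \<and> f (Suc i) \<in> B \<and> E (f i) (f (Suc i))"
    unfolding rtrancl_power relpow_fun_conv by auto
  have fB: "f i \<in> B" if "i \<le> m" for i
    using f ab that by (cases "i = m") auto
  define p where "p i = (if i = 0 then a else if i = m + 2 then b else f (i - 1))" for i
  have "E (p i) (p (Suc i))" if "i < m + 2" for i
  proof (cases i)
    case (Suc j)
    then show ?thesis using f ab that by (cases "j = m") (auto simp: p_def)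
  qed (use f ab in \<open>simp add: p_def\<close>)
  moreover have "p i \<in> B" if "0 < i" "i < m + 2" for i
    using that fB by (auto simp: p_def)
  ultimately have "path_through B a b (m + 2) p"
    by (simp add: path_through_def p_def)
  then show ?thesis by blast
qed

text \<open>Covers both defects of a walk. A chord from \<open>p i\<close> to \<open>p j\<close> is
  used with \<open>d = j - i - 1\<close>, a repetition \<open>p i = p j\<close> with
  \<open>d = j - i\<close>; \<open>stop\<close> is the repetition of the last vertex, which has no
  successor.\<close>

lemma path_shortcut:
  assumes p: "path_through B a b n p" and "i + d \<le> n"
    and step: "i + d < n \<Longrightarrow> E (p i) (p (Suc (i + d)))" and stop: "i + d = n \<Longrightarrow> p i = b"
  shows "\<exists>q. path_through B a b (n - d) q"
proof -
  define q where "q k = (if k \<le> i then p k else p (k + d))" for k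
  have "q 0 = a" using p by (simp add: q_def path_through_def)
  moreover have "q (n - d) = b"
  proof (cases "i + d = n")
    case True
    then have "n - d = i" by simp
    then show ?thesis using stop[OF True] by (simp add: q_def)
  next
    case False
    then have "i < n - d" "n - d + d = n" using assms(2) by simp_all
    then show ?thesis using p by (simp add: q_def path_through_def)
  qed
  moreover have "E (q k) (q (Suc k))" if "k < n - d" for k
  proof -
    consider "k < i" | "k = i" | "i < k" by linarith
    then show ?thesis
      using p step that assms(2) by cases (auto simp: q_def path_through_def)
  qed
  moreover have "q k \<in> B" if "0 < k" "k < n - d" for k
    using p that by (auto simp: q_def path_through_def)
  ultimately show ?thesis unfolding path_through_def by blast
qed

text \<open>A shortest walk admits no shortcut. It need not meet \<open>B\<close>: if
  \<open>a\<close> and \<open>b\<close> are equal or adjacent, its length is 0 or 1.\<close>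

lemma induced_path_through:
  assumes "connected_in B" "x \<in> B" "E a x" "y \<in> B" "E y b"
  obtains n p where "path_through B a b n p" "inj_on p {..n}"
    "\<And>i j. i \<le> n \<Longrightarrow> j \<le> n \<Longrightarrow> E (p i) (p j) \<longleftrightarrow> j = Suc i \<or> i = Suc j"
proof -
  define n where "n = (LEAST n. \<exists>p. path_through B a b n p)"
  obtain p where p: "path_through B a b n p"
    using LeastI_ex[OF path_through_exists[OF assms]] by (auto simp: n_def)
  have least: False if "path_through B a b m q" "m < n" for m q
    using that not_less_Least unfolding n_def by blast
  have ne: "p i \<noteq> p j" if ij: "i < j" "j \<le> n" for i j
  proof
    assume eq: "p i = p j"
    have "\<exists>q. path_through B a b (n - (j - i)) q"
      by (rule path_shortcut[OF p, of i]) (use ij eq p in \<open>auto simp: path_through_def\<close>)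
    then show False using least ij by force
  qed
  have nadj: "\<not> E (p i) (p j)" if ij: "Suc i < j" "j \<le> n" for i j
  proof
    assume adj: "E (p i) (p j)"
    have "\<exists>q. path_through B a b (n - (j - i - 1)) q"
      by (rule path_shortcut[OF p, of i]) (use ij adj in auto)
    then show False using least ij by force
  qed
  have "inj_on p {..n}"
    by (rule linorder_inj_onI) (use ne in auto)
  moreover have "E (p i) (p j) \<longleftrightarrow> j = Suc i \<or> i = Suc j" if "i \<le> n" "j \<le> n" for i j
  proof -
    have step: "E (p k) (p (Suc k))" if "k < n" for k
      using p that by (simp add: path_through_def)
    consider "i = j" | "j = Suc i" | "i = Suc j" | "Suc i < j" | "Suc j < i" by linarith
    then show ?thesis
      using that step[of i] step[of j] nadj[of i j] nadj[of j i] sym[of "p i" "p j"]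
        sym[of "p j" "p i"] irrefl[of "p i"]
      by cases auto
  qed
  ultimately show ?thesis using that p by blast
qed

lemma long_cycle:
  assumes B: "connected_in B" "B \<subseteq> W" and P: "induced_path3 W x y z"
    and away: "\<And>q b. q \<in> {x, y, z} \<Longrightarrow> b \<in> B \<Longrightarrow> q \<noteq> b \<and> \<not> E q b"
    and a: "a \<in> W" "a \<notin> B" "E a x" "\<not> E a y" "\<not> E a z" "u \<in> B" "E a u"
    and b: "b \<in> W" "b \<notin> B" "E z b" "\<not> E x b" "\<not> E y b" "v \<in> B" "E b v"
    and ab: "\<not> E a b"
  shows "\<exists>U n f. U \<subseteq> W \<and> 6 \<le> n \<and> cycle_labelling U n f"
proof -
  obtain l p where p: "path_through B a b l p" and inj: "inj_on p {..l}"
    and adj: "\<And>i j. i \<le> l \<Longrightarrow> j \<le> l \<Longrightarrow> E (p i) (p j) \<longleftrightarrow> j = Suc i \<or> i = Suc j"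
    using induced_path_through[OF B(1) \<open>u \<in> B\<close> \<open>E a u\<close> \<open>v \<in> B\<close> sym[OF \<open>E b v\<close>]] by metis
  have p0: "p 0 = a" and pl: "p l = b" and pB: "\<And>i. 0 < i \<Longrightarrow> i < l \<Longrightarrow> p i \<in> B"
    using p by (auto simp: path_through_def)
  have xyz: "x \<in> W" "y \<in> W" "z \<in> W" "E x y" "E y z" "\<not> E x z" "x \<noteq> z"
    using P by (auto simp: induced_path3_def)
  have "a \<noteq> b" using a b sym by blast
  \<comment> \<open>This puts a vertex of \<open>B\<close> on the path, the sixth vertex besides
    \<open>a\<close>, \<open>b\<close>, \<open>x\<close>, \<open>y\<close>,
    \<open>z\<close>.\<close>
  have l: "l \<ge> 2"
  proof (rule ccontr)
    assume "\<not> l \<ge> 2"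
    then have "l = 0 \<or> l = 1" by linarith
    then show False using p0 pl \<open>a \<noteq> b\<close> ab adj[of 0 1] by auto
  qed
  \<comment> \<open>The cycle follows the path from \<open>a\<close> to \<open>b\<close> and returns
    through \<open>z\<close>, \<open>y\<close>, \<open>x\<close>. The path has \<open>l + 1\<close>
    vertices, whence the length \<open>l + 4\<close>.\<close>
  define f where "f i = (if i \<le> l then p i else if i = l + 1 then z else if i = l + 2 then y else x)"
    for i
  have end_a: "E x a" "\<not> E y a" "\<not> E z a" "a \<noteq> x" "a \<noteq> y" "a \<noteq> z"
    using a xyz sym irrefl by metis+
  have end_b: "E z b" "\<not> E x b" "\<not> E y b" "b \<noteq> x" "b \<noteq> y" "b \<noteq> z"
    using b xyz sym irrefl by metis+
  have inner: "\<not> E q (p i) \<and> p i \<noteq> q" if "q \<in> {x, y, z}" "i \<le> l" "i \<noteq> 0" "i \<noteq> l" for q i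
    using away[OF that(1) pB[of i]] that by auto
  have "l \<noteq> 0" using l by simp
  have px: "E x (p i) \<longleftrightarrow> i = 0" "p i \<noteq> x" if "i \<le> l" for i
    using inner[of x i] that end_a end_b p0 pl \<open>l \<noteq> 0\<close> by (cases "i = 0"; cases "i = l"; simp)+
  have py: "\<not> E y (p i)" "p i \<noteq> y" if "i \<le> l" for i
    using inner[of y i] that end_a end_b p0 pl \<open>l \<noteq> 0\<close> by (cases "i = 0"; cases "i = l"; simp)+
  have pz: "E z (p i) \<longleftrightarrow> i = l" "p i \<noteq> z" if "i \<le> l" for i
    using inner[of z i] that end_a end_b p0 pl \<open>l \<noteq> 0\<close> by (cases "i = 0"; cases "i = l"; simp)+
  have split: "i \<le> l \<or> i = l + 1 \<or> i = l + 2 \<or> i = l + 3" if "i < l + 4" for i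
    using that by linarith
  have px': "E (p i) x \<longleftrightarrow> i = 0" "\<not> E (p i) y" "E (p i) z \<longleftrightarrow> i = l" if "i \<le> l" for i
    using px[OF that] py[OF that] pz[OF that] sym by metis+
  have xyz': "E y x" "E z y" "\<not> E z x" "x \<noteq> y" "y \<noteq> z" using xyz sym irrefl by metis+
  have "f i \<noteq> f j" if "i < j" "j < l + 4" for i j
  proof -
    have "p i \<noteq> p j" if "j \<le> l"
      using inj that \<open>i < j\<close> by (auto dest: inj_onD)
    moreover have "i < l + 4" using that by simp
    ultimately show ?thesis
      using split[OF \<open>i < l + 4\<close>] split[OF that(2)] that(1)
      by (elim disjE) (simp_all add: f_def px py pz xyz xyz' xyz(7)[symmetric] xyz'(4,5)[symmetric])
  qed
  then have inj_f: "inj_on f {..<l + 4}"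
    by (intro linorder_inj_onI) auto
  have adj_f: "E (f i) (f j) \<longleftrightarrow> j = Suc i mod (l + 4) \<or> i = Suc j mod (l + 4)"
    if "i < l + 4" "j < l + 4" for i j
  proof -
    have S: "Suc k mod (l + 4) = (if k = l + 3 then 0 else Suc k)" if "k < l + 4" for k
    proof (cases "k = l + 3")
      case True
      then have "Suc k = l + 4" by simp
      then have "Suc k mod (l + 4) = 0" by (simp only: mod_self)
      then show ?thesis using True by simp
    qed (use that in simp)
    show ?thesis
      unfolding S[OF that(1)] S[OF that(2)]
      using split[OF that(1)] split[OF that(2)]
      by (elim disjE; simp add: f_def px(1) py(1) pz(1) px' xyz(4-6) xyz' irrefl adj) auto
  qed
  have "cycle_labelling (f ` {..<l + 4}) (l + 4) f"
    unfolding cycle_labelling_def bij_betw_def by (intro conjI allI impI inj_f adj_f refl)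
  moreover have "p i \<in> W" if "i \<le> l" for i
    using that pB[of i] p0 pl a(1) b(1) B(2) by (cases "i = 0 \<or> i = l") auto
  then have "f ` {..<l + 4} \<subseteq> W" using xyz(1-3) by (simp add: f_def image_subset_iff)
  ultimately show ?thesis
    using l by (intro exI[of _ "f ` {..<l + 4}"] exI[of _ "l + 4"] exI[of _ f]) simp
qed

section \<open>Existence of a three-vertex path that is not extendable\<close>

lemma extendableE:
  assumes "extendable W x y z"
  obtains a b where "a \<in> W" "E a x" "\<not> E a y" "\<not> E a z"
    "b \<in> W" "E z b" "\<not> E x b" "\<not> E y b" "\<not> E a b"
  using assms by (auto simp: extendable_def)

definition away :: "'a set \<Rightarrow> 'a set \<Rightarrow> bool" where
  "away Q B \<longleftrightarrow> Q \<inter> B = {} \<and> (\<forall>q\<in>Q. \<forall>b\<in>B. \<not> E q b)"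

text \<open>
  A maximal connected set \<open>B\<close> avoiding the closed neighbourhood of some induced path with three
  vertices has the property that each of its neighbours is adjacent to every such path away
  from \<open>B\<close>. Hence a path that is not extendable after deleting \<open>B\<close> and its neighbours could
  only be extended by two neighbours of \<open>B\<close>, and these close a long induced cycle through \<open>B\<close>.
\<close>

lemma simplicial_path3:
  assumes "finite W" "\<And>U n f. U \<subseteq> W \<Longrightarrow> cycle_labelling U n f \<Longrightarrow> n < 6"
    and "induced_path3 W x y z"
  shows "\<exists>x y z. induced_path3 W x y z \<and> \<not> extendable W x y z"
  using assms
proof (induction W arbitrary: x y z rule: finite_psubset_induct)
  case (psubset W)
  define good where "good B \<longleftrightarrow> B \<subseteq> W \<and> B \<noteq> {} \<and> connected_in B \<and>
    (\<exists>x y z. induced_path3 W x y z \<and> away {x, y, z} B)" for B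
  have goodI: "good B" if "B \<subseteq> W" "B \<noteq> {}" "connected_in B" "induced_path3 W x y z" "away {x, y, z} B"
    for B x y z
    unfolding good_def using that(4,5) by (intro conjI that(1-3)) iprover
  show ?case
  proof (rule ccontr)
    assume "\<not> ?thesis"
    then have ext: "extendable W x y z" if "induced_path3 W x y z" for x y z
      using that by blast
    obtain a b where ab: "a \<in> W" "b \<in> W" "E a x" "\<not> E a y" "\<not> E a z" "E z b" "\<not> E x b" "\<not> E y b" "\<not> E a b"
      using ext[OF psubset.prems(2)] unfolding extendable_def by blast
    have xyz: "x \<in> W" "y \<in> W" "E x y" "E y z" "\<not> E x z"
      using psubset.prems(2) by (auto simp: induced_path3_def)
    have "a \<noteq> y" "b \<noteq> a" "b \<noteq> x" "b \<noteq> y" 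
      using ab xyz sym by (metis, metis, metis, metis)
    \<comment> \<open>The end \<open>b\<close> of an extended path is a first good set, since
      \<open>a\<close>, \<open>x\<close>, \<open>y\<close> stay away from it.\<close>
    then have "induced_path3 W a x y" "away {a, x, y} {b}"
      using ab xyz by (simp_all add: induced_path3_def away_def)
    moreover have "connected_in {b}" by (simp add: connected_in_def)
    ultimately have "good {b}"
      using ab(2) by (intro goodI) simp_all
    have "finite {B. good B}"
      by (rule finite_subset[of _ "Pow W"]) (use psubset.hyps in \<open>auto simp: good_def\<close>)
    then obtain B where B: "good B" and max: "\<And>C. good C \<Longrightarrow> B \<subseteq> C \<Longrightarrow> B = C"
      using finite_has_maximal2[of "{B. good B}" "{b}"] \<open>good {b}\<close> by auto
    define N where "N = {s \<in> W - B. \<exists>b\<in>B. E s b}"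
    define R where "R = W - B - N"
    have BW: "B \<subseteq> W" "B \<noteq> {}" "connected_in B" using B by (simp_all add: good_def)
    have R_away: "away Q B" if "Q \<subseteq> R" for Q
      using that unfolding away_def R_def N_def by blast
    \<comment> \<open>Otherwise \<open>insert s B\<close> would be a larger good set.\<close>
    have dominates: "E s u \<or> E s v \<or> E s w" if P: "induced_path3 R u v w" and s: "s \<in> N" for s u v w
    proof (rule ccontr)
      assume not: "\<not> ?thesis"
      have sub: "{u, v, w} \<subseteq> R" using P by (simp add: induced_path3_def)
      have "s \<notin> {u, v, w}" using sub s by (auto simp: R_def)
      moreover have "\<not> E u s" "\<not> E v s" "\<not> E w s" using not sym by blast+
      ultimately have "away {u, v, w} (insert s B)"
        using R_away[OF sub] by (simp add: away_def)
      moreover have "induced_path3 W u v w" using P by (auto simp: induced_path3_def R_def)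
      moreover have "connected_in (insert s B)"
        using s connected_insert[OF BW(3)] by (auto simp: N_def)
      moreover have "insert s B \<subseteq> W" using s BW by (auto simp: N_def)
      ultimately have "good (insert s B)" by (intro goodI) simp_all
      then have "B = insert s B" using max by blast
      then show False using s by (auto simp: N_def)
    qed
    obtain u v w where "induced_path3 W u v w" "away {u, v, w} B"
      using B unfolding good_def by blast
    then have uvw: "induced_path3 R u v w"
      by (auto simp: induced_path3_def R_def N_def away_def)
    \<comment> \<open>\<open>R\<close> is smaller because \<open>B\<close> is nonempty, and it still
      contains an induced path, so the induction hypothesis applies to it.\<close>
    have "R \<subset> W" using BW by (auto simp: R_def)
    have "n < 6" if "U \<subseteq> R" "cycle_labelling U n f" for U n f
      using psubset.prems(1) that by (auto simp: R_def)
    then obtain x y z where P: "induced_path3 R x y z" and not_ext: "\<not> extendable R x y z"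
      using psubset.IH[OF \<open>R \<subset> W\<close> _ uvw] by meson
    have PW: "induced_path3 W x y z" using P by (auto simp: induced_path3_def R_def)
    obtain a b where a: "a \<in> W" "E a x" "\<not> E a y" "\<not> E a z"
      and b: "b \<in> W" "E z b" "\<not> E x b" "\<not> E y b" and nab: "\<not> E a b"
      by (rule extendableE[OF ext[OF PW]])
    have sub: "x \<in> R" "y \<in> R" "z \<in> R" and path: "E x y" "E y z" "\<not> E x z" "x \<noteq> z"
      using P by (auto simp: induced_path3_def)
    have "a \<notin> B" "b \<notin> B"
      using R_away[of "{x, z}"] sub a(2) b(2) sym[of a x] by (auto simp: away_def)
    have P1: "induced_path3 R y z b" if "b \<in> R"
      using that sub path b by (auto simp: induced_path3_def)
    have P2: "induced_path3 R a x y" if "a \<in> R"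
      using that sub path a sym[of y a] by (auto simp: induced_path3_def)
    \<comment> \<open>If \<open>a\<close> were in \<open>R\<close>, then \<open>a\<close>,
      \<open>x\<close>, \<open>y\<close> would be an induced path in \<open>R\<close> that
      \<open>b\<close> does not touch; so \<open>b\<close> would lie in \<open>R\<close> too and the
      path would be extendable there.\<close>
    have "a \<in> N"
    proof (rule ccontr)
      assume "a \<notin> N"
      then have "a \<in> R" using a(1) \<open>a \<notin> B\<close> by (simp add: R_def)
      have "b \<notin> N"
        using dominates[OF P2[OF \<open>a \<in> R\<close>], of b] b(3,4) sym[of b] nab by blast
      then have "b \<in> R" using b(1) \<open>b \<notin> B\<close> by (simp add: R_def)
      have "extendable R x y z"
        unfolding extendable_def
        by (intro bexI[of _ a] bexI[of _ b] conjI a b nab \<open>a \<in> R\<close> \<open>b \<in> R\<close>)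
      then show False using not_ext by blast
    qed
    \<comment> \<open>If \<open>b\<close> were in \<open>R\<close>, then \<open>y\<close>,
      \<open>z\<close>, \<open>b\<close> would be an induced path in \<open>R\<close> not touched by
      \<open>a\<close>, against \<open>a \<in> N\<close>.\<close>
    have "b \<in> N"
    proof (rule ccontr)
      assume "b \<notin> N"
      then have "b \<in> R" using b(1) \<open>b \<notin> B\<close> by (simp add: R_def)
      then show False
        using dominates[OF P1[OF \<open>b \<in> R\<close>] \<open>a \<in> N\<close>] a(3,4) nab by simp
    qed
    obtain s t where st: "s \<in> B" "E a s" "t \<in> B" "E b t"
      using \<open>a \<in> N\<close> \<open>b \<in> N\<close> by (auto simp: N_def)
    have "q \<noteq> b \<and> \<not> E q b" if "q \<in> {x, y, z}" "b \<in> B" for q b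
      using R_away[of "{x, y, z}"] sub that by (auto simp: away_def)
    then obtain U n f where "U \<subseteq> W" "6 \<le> n" "cycle_labelling U n f"
      using long_cycle[OF BW(3) BW(1) PW _ a(1) \<open>a \<notin> B\<close> a(2-4) st(1,2) b(1) \<open>b \<notin> B\<close> b(2-4) st(3,4)
          nab] by meson
    then show False using psubset.prems(1)[of U n f] by simp
  qed
qed

lemma shedding_exists:
  assumes "finite W" "u \<in> W" "v \<in> W" "E u v"
    and cyc: "\<And>U n f. U \<subseteq> W \<Longrightarrow> cycle_labelling U n f \<Longrightarrow> n < 6 \<and> n \<noteq> 4"
  shows "\<exists>w. shedding W w"
proof (cases "\<exists>x y z. induced_path3 W x y z")
  case True
  then obtain x y z where "induced_path3 W x y z" "\<not> extendable W x y z"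
    using simplicial_path3[OF \<open>finite W\<close>] cyc by blast
  then have "shedding W y" using path3_shedding cyc by blast
  then show ?thesis ..
next
  case False
  then show ?thesis using edge_shedding[OF assms(2-4)] by blast
qed

section \<open>Proper subsets of cycles\<close>

text \<open>The same labelling indexed by all integers, so that rotations of the cycle are translations.\<close>

definition int_cycle :: "'a set \<Rightarrow> int \<Rightarrow> (int \<Rightarrow> 'a) \<Rightarrow> bool" where
  "int_cycle U n c \<longleftrightarrow> n \<ge> 3 \<and> range c = U \<and> (\<forall>i j. c i = c j \<longleftrightarrow> n dvd i - j) \<and>
     (\<forall>i j. E (c i) (c j) \<longleftrightarrow> n dvd j - i - 1 \<or> n dvd i - j - 1)"

lemma int_cycle_of_labelling:
  assumes f: "cycle_labelling U n f" and n: "n \<ge> 3"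
  shows "int_cycle U (int n) (\<lambda>i. f (nat (i mod int n)))"
proof -
  define h where "h i = nat (i mod int n)" for i
  have h_less: "h i < n" for i using n by (simp add: h_def nat_less_iff)
  have h_eq: "h i = h j \<longleftrightarrow> int n dvd i - j" for i j
    using n by (simp add: h_def eq_nat_nat_iff mod_eq_dvd_iff)
  have h_Suc: "Suc (h i) mod n = h (i + 1)" for i
  proof -
    have "int (Suc (h i) mod n) = (i mod int n + 1) mod int n"
      using n by (simp add: h_def zmod_int add.commute)
    also have "\<dots> = int (h (i + 1))" using n by (simp add: h_def mod_simps)
    finally show ?thesis by simp
  qed
  have inj: "inj_on f {..<n}" and img: "f ` {..<n} = U"
    using f by (auto simp: cycle_labelling_def bij_betw_def)
  have "range (\<lambda>i. f (h i)) = U"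
  proof -
    have "k \<in> range h" if "k < n" for k
      using that n by (intro image_eqI[of _ _ "int k"]) (simp_all add: h_def)
    then have "range h = {..<n}" using h_less by blast
    then show ?thesis using img by (metis image_image)
  qed
  moreover have "f (h i) = f (h j) \<longleftrightarrow> int n dvd i - j" for i j
    using inj h_less h_eq by (metis inj_onD lessThan_iff)
  moreover have "E (f (h i)) (f (h j)) \<longleftrightarrow> int n dvd j - i - 1 \<or> int n dvd i - j - 1" for i j
  proof -
    have "E (f (h i)) (f (h j)) \<longleftrightarrow> h j = h (i + 1) \<or> h i = h (j + 1)"
      using f h_less unfolding cycle_labelling_def h_Suc[symmetric] by blast
    then show ?thesis unfolding h_eq by (simp add: algebra_simps)
  qed
  ultimately show ?thesis using n by (simp add: int_cycle_def h_def)
qed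

lemma cycle_labelling_finite: "cycle_labelling U n f \<Longrightarrow> finite U"
  by (auto simp: cycle_labelling_def bij_betw_def)

lemma int_cycle_neighbour:
  assumes "int_cycle U n c" "v \<in> U" "E (c i) v"
  shows "v = c (i + 1) \<or> v = c (i - 1)"
proof -
  obtain k where k: "v = c k" using assms by (auto simp: int_cycle_def)
  have "n dvd k - i - 1 \<or> n dvd i - k - 1" using assms k by (auto simp: int_cycle_def)
  moreover have "n dvd i - k - 1 \<longleftrightarrow> n dvd k - (i - 1)"
    using dvd_minus_iff[of n "i - k - 1"] by (simp add: algebra_simps)
  ultimately have "n dvd k - (i + 1) \<or> n dvd k - (i - 1)" by (simp add: algebra_simps)
  then show ?thesis using assms(1) unfolding k int_cycle_def by blast
qed

text \<open>The neighbour of an endpoint of a path component is a shedding vertex.\<close>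

lemma shellable_proper_subset_cycle:
  assumes c: "int_cycle U n c" and "finite U" "W \<subset> U"
  shows "shellable (stable_sets E W)"
proof -
  have "finite W" using assms finite_subset by blast
  then show ?thesis using \<open>W \<subset> U\<close>
  proof (induction W rule: finite_psubset_induct)
    case (psubset W)
    show ?case
    proof (cases "\<exists>u\<in>W. \<exists>v\<in>W. E u v")
      case False
      then show ?thesis using shellable_edgeless psubset.hyps by blast
    next
      case True
      have edge: "\<exists>i. c i \<in> W \<and> c (i + 1) \<in> W"
      proof -
        obtain u v where uv: "u \<in> W" "v \<in> W" "E u v" using True by blast
        then obtain i where i: "u = c i" using c psubset.prems by (auto simp: int_cycle_def)
        have "v = c (i + 1) \<or> v = c (i - 1)"
          using int_cycle_neighbour[OF c] uv i psubset.prems by blast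
        then show ?thesis
        proof
          assume "v = c (i - 1)"
          then show ?thesis using uv i by (intro exI[of _ "i - 1"]) simp
        qed (use uv i in blast)
      qed
      then obtain i where i: "c i \<in> W" "c (i + 1) \<in> W" by blast
      obtain j where j: "c j \<notin> W" using c psubset.prems by (auto simp: int_cycle_def)
      \<comment> \<open>Positions are counted from the missing vertex \<open>c j\<close>; the least
        \<open>k\<close> with \<open>P k\<close> marks the start of the first path component with an
        edge.\<close>
      define P where "P k \<longleftrightarrow> c (j + int k) \<in> W \<and> c (j + int k + 1) \<in> W" for k
      have "P (nat ((i - j) mod n))"
      proof -
        have n: "n \<ge> 3" using c by (simp add: int_cycle_def)
        have "n dvd (j + (i - j) mod n) - i"
          using dvd_minus_mod[of n "i - j"] dvd_minus_iff[of n "i - j - (i - j) mod n"]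
          by (simp add: algebra_simps)
        then have "c (j + (i - j) mod n) = c i" "c (j + (i - j) mod n + 1) = c (i + 1)"
          using c by (simp_all add: int_cycle_def)
        then show ?thesis using i n by (simp add: P_def)
      qed
      then obtain k where Pk: "P k" and k_least: "\<And>l. l < k \<Longrightarrow> \<not> P l"
        using exists_least_iff[of P] by blast
      have "k \<noteq> 0"
      proof
        assume "k = 0"
        then show False using Pk j by (simp add: P_def)
      qed
      then have "\<not> P (k - 1)" using k_least by simp
      then have prev: "c (j + int k - 1) \<notin> W"
        using Pk \<open>k \<noteq> 0\<close> by (simp add: P_def of_nat_diff algebra_simps)
      let ?w = "c (j + int k)" and ?v = "c (j + int k + 1)"
      have w: "?w \<in> W" "?v \<in> W" using Pk by (simp_all add: P_def)
      have vw: "E ?v ?w" using c by (simp add: int_cycle_def)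
      \<comment> \<open>The predecessor of \<open>?w\<close> is missing, so \<open>?w\<close> is a
        leaf attached to \<open>?v\<close>. It serves as the witness for every stable set avoiding
        \<open>?v\<close>.\<close>
      have only: "x = ?v" if "x \<in> W" "E ?w x" for x
        using int_cycle_neighbour[OF c, of x "j + int k"] that prev psubset.prems by blast
      have shed: "shedding W ?v"
        unfolding shedding_def
      proof (intro conjI ballI w(2))
        fix S assume S: "S \<in> stable_sets E (W - {?v} - {u. E ?v u})"
        have "\<not> E ?w s" if "s \<in> S" for s
          using only[of s] S that by (auto simp: stable_sets_def)
        then show "\<exists>x\<in>W. E ?v x \<and> (\<forall>s\<in>S. \<not> E x s)" using w vw by blast
      qed
      have sub: "W - {?v} \<subset> W" "W - {?v} - {u. E ?v u} \<subset> W" using w by blast+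
      then have "W - {?v} \<subset> U" "W - {?v} - {u. E ?v u} \<subset> U" using psubset.prems by blast+
      then show ?thesis
        using shellable_shedding[OF psubset.hyps shed] psubset.IH[OF sub(1)] psubset.IH[OF sub(2)]
        by blast
    qed
  qed
qed

section \<open>Cycles that are not shellable\<close>

lemma int_cycle_window:
  assumes "int_cycle U n c" "v \<in> U"
  obtains s where "0 \<le> s" "s < n" "v = c (j + s)"
proof -
  have n: "n \<ge> 3" using assms by (simp add: int_cycle_def)
  obtain i where i: "v = c i" using assms by (auto simp: int_cycle_def)
  have "n dvd i - (j + (i - j) mod n)"
    using dvd_minus_mod[of n "i - j"] by (simp add: algebra_simps)
  then have "v = c (j + (i - j) mod n)" using assms i by (simp add: int_cycle_def)
  then show ?thesis using that[of "(i - j) mod n"] n by simp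
qed

lemma int_cycle_eq:
  assumes "int_cycle U n c" "\<bar>i - j\<bar> < n"
  shows "c i = c j \<longleftrightarrow> i = j"
proof -
  have "c i = c j \<longleftrightarrow> n dvd i - j" using assms by (simp add: int_cycle_def)
  then show ?thesis using assms(2) dvd_imp_le_int[of "i - j" n] by auto
qed

lemma int_cycle_period:
  "int_cycle U n c \<Longrightarrow> c (i + n) = c i"
  by (simp add: int_cycle_def)

lemma int_cycle_step:
  assumes "int_cycle U n c"
  shows "E (c i) (c (i + 1))" "E (c i) (c (i - 1))"
  using assms by (simp_all add: int_cycle_def)

lemma int_cycle_adj:
  assumes "int_cycle U n c" "\<bar>i - j\<bar> < n" "E (c i) (c j)"
  shows "\<bar>i - j\<bar> = 1 \<or> \<bar>i - j\<bar> = n - 1"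
proof -
  \<comment> \<open>The range is asymmetric because \<open>j - i - 1\<close> can reach
    \<open>- n\<close> but not \<open>n\<close>; the value \<open>- n\<close> is adjacency across
    the wrap.\<close>
  have small: "x = 0 \<or> x = - n" if "n dvd x" "- n \<le> x" "x < n" for x
  proof -
    have "x = 0" if "\<bar>x\<bar> < n" using dvd_imp_le_int[OF _ \<open>n dvd x\<close>] that by auto
    then show ?thesis using that by linarith
  qed
  have "n dvd j - i - 1 \<or> n dvd i - j - 1" using assms by (simp add: int_cycle_def)
  then show ?thesis using small[of "j - i - 1"] small[of "i - j - 1"] assms(2) by linarith
qed

text \<open>With \<open>m = n div 2\<close> this is a maximum stable set of the cycle. For even
  \<open>n\<close> it depends only on the parity of \<open>j\<close>; for odd \<open>n\<close> it
  leaves one gap of two adjacent vertices, at offsets \<open>2 * m - 1\<close> and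
  \<open>2 * m\<close>.\<close>

definition alternate :: "(int \<Rightarrow> 'a) \<Rightarrow> int \<Rightarrow> int \<Rightarrow> 'a set" where
  "alternate c m j = (\<lambda>t. c (j + 2 * t)) ` {0..<m}"

context
  fixes U n c m
  assumes c: "int_cycle U n c" and m: "m = n div 2" "m \<ge> 2"
begin

lemma mn: "2 * m \<le> n" "n \<le> 2 * m + 1"
  using m by simp_all

lemma mem_alternate:
  assumes "0 \<le> s" "s < n"
  shows "c (j + s) \<in> alternate c m j \<longleftrightarrow> even s \<and> s < 2 * m"
proof
  assume "c (j + s) \<in> alternate c m j"
  then obtain t where t: "0 \<le> t" "t < m" "c (j + s) = c (j + 2 * t)"
    by (auto simp: alternate_def)
  then have "s = 2 * t"
    using int_cycle_eq[OF c, of "j + s" "j + 2 * t"] assms mn by auto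
  then show "even s \<and> s < 2 * m" using t by simp
next
  assume "even s \<and> s < 2 * m"
  then show "c (j + s) \<in> alternate c m j"
    using assms(1) by (auto simp: alternate_def elim!: evenE intro!: image_eqI)
qed

lemma alternate_stable: "alternate c m j \<in> stable_sets E U"
proof -
  have "\<not> E (c (j + 2 * a)) (c (j + 2 * b))" if "a \<in> {0..<m}" "b \<in> {0..<m}" for a b
  proof
    assume "E (c (j + 2 * a)) (c (j + 2 * b))"
    moreover have "\<bar>2 * a - 2 * b\<bar> < n - 1" using that mn by auto
    ultimately have "\<bar>2 * a - 2 * b\<bar> = 1"
      using int_cycle_adj[OF c, of "j + 2 * a" "j + 2 * b"] by simp
    then show False by presburger
  qed
  moreover have "alternate c m j \<subseteq> U" using c by (auto simp: alternate_def int_cycle_def)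
  ultimately show ?thesis unfolding stable_sets_def alternate_def by blast
qed

lemma odd_position_neighbours:
  assumes "odd s" "0 \<le> s" "s < n"
  shows "c (j + (s - 1)) \<in> alternate c m j" "E (c (j + s)) (c (j + (s - 1)))"
    "E (c (j + s)) (c (j + (s + 1)))" "c (j + (s - 1)) \<noteq> c (j + (s + 1))"
    "s < 2 * m - 1 \<or> n = 2 * m \<Longrightarrow> c (j + (s + 1)) \<in> alternate c m j"
proof -
  have s: "1 \<le> s" "s \<le> 2 * m - 1" using assms mn by presburger+
  show "c (j + (s - 1)) \<in> alternate c m j"
    using mem_alternate[of "s - 1" j] assms s mn by simp
  show "E (c (j + s)) (c (j + (s - 1)))" "E (c (j + s)) (c (j + (s + 1)))"
    using int_cycle_step[OF c, of "j + s"] by (simp_all add: algebra_simps)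
  show "c (j + (s - 1)) \<noteq> c (j + (s + 1))"
    using int_cycle_eq[OF c, of "j + (s - 1)" "j + (s + 1)"] mn m(2) by simp
  assume "s < 2 * m - 1 \<or> n = 2 * m"
  then consider "s < 2 * m - 1" | "n = 2 * m" "s = 2 * m - 1" using s by linarith
  then show "c (j + (s + 1)) \<in> alternate c m j"
  proof cases
    case 1
    then show ?thesis using mem_alternate[of "s + 1" j] assms s mn by simp
  next
    case 2
    \<comment> \<open>For even \<open>n\<close> the last odd position is followed by position
      \<open>n\<close>, which is the start again.\<close>
    then have "c (j + (s + 1)) = c (j + 0)" using int_cycle_period[OF c, of j] by simp
    then show ?thesis using mem_alternate[of 0 j] m(2) mn by simp
  qed
qed

text \<open>The four kinds of vertices relative to \<open>alternate c m j\<close>: members, vertices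
  with both neighbours in it, and for odd \<open>n\<close> the two gap vertices, each with just one
  neighbour in it.\<close>

lemma position_cases:
  assumes "0 \<le> s" "s < n"
  obtains "even s" "s < 2 * m" | "odd s" "s < 2 * m - 1 \<or> n = 2 * m"
    | "n = 2 * m + 1" "s = 2 * m - 1" | "n = 2 * m + 1" "s = 2 * m"
proof -
  have "even s \<and> s < 2 * m \<or> odd s \<and> (s < 2 * m - 1 \<or> n = 2 * m) \<or>
      n = 2 * m + 1 \<and> s = 2 * m - 1 \<or> n = 2 * m + 1 \<and> s = 2 * m"
    using assms mn by presburger
  then show ?thesis using that by blast
qed

lemma wrap_neighbour:
  assumes "n = 2 * m + 1"
  shows "E (c (j + 2 * m)) (c j)"
proof -
  have "c j = c (j + 2 * m + 1)" using int_cycle_period[OF c, of j] assms by (simp add: add.assoc)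
  then show ?thesis using int_cycle_step(1)[OF c, of "j + 2 * m"] by simp
qed

lemma endpoints_alternate:
  "c j \<in> alternate c m j" "c (j + (2 * m - 2)) \<in> alternate c m j"
  using mem_alternate[of 0 j] mem_alternate[of "2 * m - 2" j] m(2) mn by simp_all

lemma alternate_facet: "alternate c m j \<in> complex_facets (stable_sets E U)"
  unfolding complex_facets_def
proof (intro CollectI conjI ballI impI alternate_stable)
  fix G assume G: "G \<in> stable_sets E U" "alternate c m j \<subseteq> G"
  have indep: "\<not> E u v" if "u \<in> G" "v \<in> G" for u v
    using G(1) that by (simp add: stable_sets_def)
  have "v \<in> alternate c m j" if "v \<in> G" for v
  proof -
    have "v \<in> U" using G(1) that by (auto simp: stable_sets_def)
    then obtain s where s: "0 \<le> s" "s < n" "v = c (j + s)"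
      using int_cycle_window[OF c, of v j] by blast
    show ?thesis
    proof (cases "odd s")
      case True
      then show ?thesis
        using odd_position_neighbours(1,2)[OF _ s(1,2), of j] indep[OF that] G(2) s(3) by blast
    next
      case False
      show ?thesis
      proof (cases "s < 2 * m")
        case True
        then show ?thesis using mem_alternate[OF s(1,2), of j] False s(3) by simp
      next
        case False
        then have "s = 2 * m" "n = 2 * m + 1" using s mn by linarith+
        then show ?thesis
          using wrap_neighbour[of j] indep[OF that] G(2) s(3) endpoints_alternate(1)[of j] by blast
      qed
    qed
  qed
  then show "G = alternate c m j" using G(2) by blast
qed

text \<open>A vertex of \<open>A\<close> can be adjacent to no member except \<open>x\<close>. This
  excludes vertices with two neighbours in the set, so only a gap vertex can be new, and it forces
  \<open>x\<close> to be the end next to it. Exchanging an end for the gap vertex beside the other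
  end would leave a conflict; exchanging it for its own neighbour shifts the set by two.\<close>

lemma alternate_ridge:
  assumes A: "A \<in> complex_facets (stable_sets E U)" "A \<noteq> alternate c m j"
    and x: "x \<in> alternate c m j" "alternate c m j - {x} \<subseteq> A"
  shows "n = 2 * m + 1 \<and> (x = c j \<and> A = alternate c m (j + 2) \<or>
           x = c (j + (2 * m - 2)) \<and> A = alternate c m (j - 2))"
proof -
  note antichain = facets_antichain[OF A(1) alternate_facet]
  have indep: "\<not> E u v" if "u \<in> A" "v \<in> A" for u v
    using A(1) that by (simp add: complex_facets_def stable_sets_def)
  have "x \<notin> A"
  proof
    assume "x \<in> A"
    then have "alternate c m j \<subseteq> A" using x(2) by blast
    then show False using facets_antichain[OF alternate_facet A(1)] A(2) by blast
  qed
  have mem: "v \<in> alternate c m j - {x} \<or>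
      n = 2 * m + 1 \<and> (v = c (j + 2 * m) \<and> x = c j \<or>
        v = c (j + (2 * m - 1)) \<and> x = c (j + (2 * m - 2)))" if "v \<in> A" for v
  proof -
    have "v \<in> U" using A(1) that by (auto simp: complex_facets_def stable_sets_def)
    then obtain s where s: "0 \<le> s" "s < n" "v = c (j + s)"
      using int_cycle_window[OF c, of v j] by blast
    have blocked: "w = x" if "w \<in> alternate c m j" "E v w" for w
      using indep[OF \<open>v \<in> A\<close>, of w] that x(2) by blast
    show ?thesis
      using s(1,2)
    proof (cases rule: position_cases)
      case 1
      then have "v \<in> alternate c m j" using mem_alternate[OF s(1,2), of j] s(3) by simp
      then show ?thesis using that \<open>x \<notin> A\<close> by blast
    next
      case 2
      note nb = odd_position_neighbours[OF 2(1) s(1,2), of j]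
      have "c (j + (s - 1)) = x" "c (j + (s + 1)) = x"
        using blocked[OF nb(1)] blocked[OF nb(5)[OF 2(2)]] nb(2,3) s(3) by blast+
      then show ?thesis using nb(4) by simp
    next
      case 3
      then have "odd s" by simp
      note nb = odd_position_neighbours[OF this s(1,2), of j]
      have "c (j + (s - 1)) = x" using blocked[OF nb(1)] nb(2) s(3) by blast
      then show ?thesis using 3 s(3) by simp
    next
      case 4
      have "c j = x"
        using blocked[OF endpoints_alternate(1)] wrap_neighbour[OF 4(1), of j] 4 s(3) by simp
      then show ?thesis using 4 s(3) by simp
    qed
  qed
  have ends: "c j \<noteq> c (j + (2 * m - 2))"
    using int_cycle_eq[OF c, of j "j + (2 * m - 2)"] m(2) mn by simp
  have "\<not> A \<subseteq> alternate c m j - {x}" using antichain[of j] A(2) by blast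
  then have n: "n = 2 * m + 1" and "x = c j \<or> x = c (j + (2 * m - 2))" using mem by blast+
  then consider "x = c j" "x \<noteq> c (j + (2 * m - 2))" | "x = c (j + (2 * m - 2))" "x \<noteq> c j"
    using ends by metis
  then show ?thesis
  proof cases
    case 1
    have "v \<in> alternate c m (j + 2)" if "v \<in> A" for v
    proof -
      consider "v \<in> alternate c m j - {x}" | "v = c (j + 2 * m)" using mem[OF \<open>v \<in> A\<close>] 1 by blast
      then have "\<exists>t. 1 \<le> t \<and> t \<le> m \<and> v = c (j + 2 * t)"
      proof cases
        case 1
        then obtain t where t: "0 \<le> t" "t < m" "v = c (j + 2 * t)" "v \<noteq> x"
          by (auto simp: alternate_def)
        then have "t \<noteq> 0" using \<open>x = c j\<close> by auto
        then show ?thesis using t by (intro exI[of _ t]) simp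
      next
        case 2
        then show ?thesis using m(2) by (intro exI[of _ m]) simp
      qed
      then obtain t where "1 \<le> t" "t \<le> m" "v = c (j + 2 * t)" by blast
      then show ?thesis
        unfolding alternate_def by (intro image_eqI[of _ _ "t - 1"]) (simp_all add: algebra_simps)
    qed
    \<comment> \<open>One inclusion suffices, since both sides are facets.\<close>
    then have "A = alternate c m (j + 2)" using antichain by blast
    then show ?thesis using 1 n by blast
  next
    case 2
    have "v \<in> alternate c m (j - 2)" if "v \<in> A" for v
    proof -
      consider "v \<in> alternate c m j - {x}" | "v = c (j + (2 * m - 1))" using mem[OF \<open>v \<in> A\<close>] 2 by blast
      then have "\<exists>t. - 1 \<le> t \<and> t < m - 1 \<and> v = c (j + 2 * t)"
      proof cases
        case 1
        then obtain t where t: "0 \<le> t" "t < m" "v = c (j + 2 * t)" "v \<noteq> x"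
          by (auto simp: alternate_def)
        then have "t \<noteq> m - 1" using \<open>x = c (j + (2 * m - 2))\<close> by (auto simp: algebra_simps)
        then show ?thesis using t by (intro exI[of _ t]) simp
      next
        case 2
        then have "v = c (j - 2)"
          using int_cycle_period[OF c, of "j - 2"] n by (simp add: algebra_simps)
        then show ?thesis using m(2) by (intro exI[of _ "- 1"]) simp
      qed
      then obtain t where "- 1 \<le> t" "t < m - 1" "v = c (j + 2 * t)" by blast
      then show ?thesis
        unfolding alternate_def by (intro image_eqI[of _ _ "t + 1"]) (simp_all add: algebra_simps)
    qed
    then have "A = alternate c m (j - 2)" using antichain by blast
    then show ?thesis using 2 n by blast
  qed
qed

text \<open>
  For even \<open>n\<close> no ridge of an alternating facet lies in another facet, so neither of the two
  alternating facets can come second. For odd \<open>n\<close> the alternating facets form a cyclic sequence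
  in which only consecutive ones share a ridge. Let \<open>F q\<close> be the last of them in a shelling.
  The later one of its two neighbours \<open>F (q + 2)\<close> and \<open>F (q - 2)\<close> can only be attached along the
  ridge away from \<open>F q\<close>, but for \<open>m \<ge> 3\<close> the vertex opposite to this ridge is already present
  in the earlier neighbour.
\<close>

lemma int_cycle_not_shellable:
  assumes "finite U" "m \<ge> 3 \<or> n = 4"
  shows "\<not> shellable (stable_sets E U)"
proof
  assume "shellable (stable_sets E U)"
  then obtain r :: "'a set \<Rightarrow> nat" where r_inj: "inj_on r (complex_facets (stable_sets E U))"
    and r: "\<And>F G. \<lbrakk>F \<in> complex_facets (stable_sets E U); G \<in> complex_facets (stable_sets E U);
        r G < r F\<rbrakk> \<Longrightarrow>
      \<exists>x\<in>F - G. \<exists>A\<in>complex_facets (stable_sets E U). r A < r F \<and> F - {x} \<subseteq> A"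
    using shellable_rank finite_stable_set[OF \<open>finite U\<close>] by (metis (no_types, lifting))
  let ?F = "alternate c m"
  have attach: "n = 2 * m + 1 \<and> (\<exists>x A. x \<notin> ?F i \<and> r A < r (?F j) \<and>
      (x = c j \<and> A = ?F (j + 2) \<or> x = c (j + (2 * m - 2)) \<and> A = ?F (j - 2)))"
    if less: "r (?F i) < r (?F j)" for i j
  proof -
    obtain x A where xA: "x \<in> ?F j - ?F i" "A \<in> complex_facets (stable_sets E U)"
      "r A < r (?F j)" "?F j - {x} \<subseteq> A"
      using r[OF alternate_facet alternate_facet less] by blast
    have "A \<noteq> ?F j" using xA by blast
    then show ?thesis using alternate_ridge[OF xA(2) \<open>A \<noteq> ?F j\<close> _ xA(4)] xA(1,3) by blast
  qed
  have r_eq: "?F i = ?F j" if "r (?F i) = r (?F j)" for i j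
    using r_inj that alternate_facet by (meson inj_onD)
  show False
  proof (cases "n = 2 * m")
    case True
    have "c (0 + 1) \<notin> ?F 0" using mem_alternate[of 1 0] m(2) mn by simp
    then have "?F 0 \<noteq> ?F 1" using endpoints_alternate(1)[of 1] by auto
    then have "r (?F 0) < r (?F 1) \<or> r (?F 1) < r (?F 0)" using r_eq[of 0 1] by linarith
    then show False using attach True by fastforce
  next
    case False
    then have n: "n = 2 * m + 1" using mn by linarith
    \<comment> \<open>\<open>n = 4\<close> is even, so the remaining alternative holds; the 5-cycle,
      with \<open>m = 2\<close>, is excluded here.\<close>
    then have "m \<ge> 3" using assms(2) by presburger
    have "finite (range (\<lambda>j. r (?F j)))"
      by (rule finite_subset[of _ "r ` complex_facets (stable_sets E U)"])
        (use alternate_facet finite_stable_sets[OF \<open>finite U\<close>] in \<open>auto simp: complex_facets_def\<close>)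
    then have "Max (range (\<lambda>j. r (?F j))) \<in> range (\<lambda>j. r (?F j))"
        "\<And>j. r (?F j) \<le> Max (range (\<lambda>j. r (?F j)))"
      by (auto intro: Max_in)
    then obtain q where q: "\<And>j. r (?F j) \<le> r (?F q)" by (metis (no_types, lifting) rangeE)
    \<comment> \<open>Seen from \<open>q + 2\<close>, the vertex \<open>c (q - 2)\<close> sits at
      the odd offset \<open>2 * m - 3\<close>; this separates the two neighbours of
      \<open>?F q\<close>.\<close>
    have "c (q - 2) = c (q + 2 + (2 * m - 3))"
      using int_cycle_period[OF c, of "q - 2"] n by (simp add: algebra_simps)
    then have "c (q - 2) \<notin> ?F (q + 2)"
      using mem_alternate[of "2 * m - 3" "q + 2"] n \<open>m \<ge> 3\<close> by simp
    then have "?F (q + 2) \<noteq> ?F (q - 2)" using endpoints_alternate(1)[of "q - 2"] by auto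
    then consider "r (?F (q - 2)) < r (?F (q + 2))" | "r (?F (q + 2)) < r (?F (q - 2))"
      using r_eq by (meson linorder_neqE_nat)
    then show False
    proof cases
      case 1
      \<comment> \<open>Offset 4 is a member offset only if \<open>4 < 2 * m\<close>, that is
        \<open>m \<ge> 3\<close>.\<close>
      have "c (q - 2 + 4) \<in> ?F (q - 2)"
        using mem_alternate[of 4 "q - 2"] n \<open>m \<ge> 3\<close> by simp
      then have "c (q + 2) \<in> ?F (q - 2)" by (simp add: add.commute)
      moreover have "\<not> r (?F (q + 2 - 2)) < r (?F (q + 2))" using q[of "q + 2"] by simp
      ultimately show False using attach[OF 1] by blast
    next
      case 2
      \<comment> \<open>The last vertex of \<open>?F (q - 2)\<close> has offset
        \<open>2 * m - 6\<close> from \<open>q + 2\<close>, which is nonnegative exactly for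
        \<open>m \<ge> 3\<close>.\<close>
      have "c (q + 2 + (2 * m - 6)) \<in> ?F (q + 2)"
        using mem_alternate[of "2 * m - 6" "q + 2"] n \<open>m \<ge> 3\<close> by simp
      then have "c (q - 2 + (2 * m - 2)) \<in> ?F (q + 2)" by (simp add: algebra_simps)
      moreover have "\<not> r (?F (q - 2 + 2)) < r (?F (q - 2))" using q[of "q - 2"] by simp
      ultimately show False using attach[OF 2] by blast
    qed
  qed
qed

end

lemma cycle_not_shellable:
  assumes "cycle_labelling U n f" "n = 4 \<or> n \<ge> 6"
  shows "\<not> shellable (stable_sets E U)"
  by (rule int_cycle_not_shellable[OF int_cycle_of_labelling[OF assms(1)] refl])
    (use assms cycle_labelling_finite in auto)

section \<open>Flag obstructions\<close>

lemma complex_verts_stable_sets: "complex_verts (stable_sets E V) = V"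
proof -
  have "{v} \<in> stable_sets E V" if "v \<in> V" for v
    using that irrefl by (simp add: stable_sets_def)
  then show ?thesis by (auto simp: complex_verts_def stable_sets_def)
qed

text \<open>Both complexes are determined by which pairs are faces, so an isomorphism of complexes
  is the same as an isomorphism of the graphs.\<close>

lemma stable_sets_image_iff:
  assumes g: "bij_betw g V V'" and irrefl': "\<And>i. i \<in> V' \<Longrightarrow> \<not> E' i i"
    and sym': "\<And>i j. E' i j \<Longrightarrow> E' j i"
  shows "(\<lambda>S. g ` S) ` stable_sets E V = stable_sets E' V' \<longleftrightarrow>
         (\<forall>u\<in>V. \<forall>v\<in>V. E u v \<longleftrightarrow> E' (g u) (g v))"
proof
  have inj: "inj_on g V" and img: "g ` V = V'" using g by (auto simp: bij_betw_def)
  {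
    assume eq: "(\<lambda>S. g ` S) ` stable_sets E V = stable_sets E' V'"
    show "\<forall>u\<in>V. \<forall>v\<in>V. E u v \<longleftrightarrow> E' (g u) (g v)"
    proof (intro ballI)
      fix u v assume uv: "u \<in> V" "v \<in> V"
      have "E u v \<longleftrightarrow> {u, v} \<notin> stable_sets E V"
        using uv irrefl sym by (simp add: stable_sets_def) blast
      also have "{u, v} \<in> stable_sets E V \<longleftrightarrow> g ` {u, v} \<in> (\<lambda>S. g ` S) ` stable_sets E V"
      proof
        assume "g ` {u, v} \<in> (\<lambda>S. g ` S) ` stable_sets E V"
        then obtain S where S: "S \<in> stable_sets E V" "g ` {u, v} = g ` S" by blast
        have "{u, v} = S"
          by (rule inj_on_image_eq_iff[OF inj, THEN iffD1])
            (use S uv in \<open>auto simp: stable_sets_def\<close>)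
        then show "{u, v} \<in> stable_sets E V" using S by simp
      qed blast
      also have "\<dots> \<longleftrightarrow> {g u, g v} \<in> stable_sets E' V'" unfolding eq by simp
      also have "\<dots> \<longleftrightarrow> \<not> E' (g u) (g v)"
        using uv img irrefl' sym' by (simp add: stable_sets_def) blast
      finally show "E u v \<longleftrightarrow> E' (g u) (g v)" by blast
    qed
  next
    assume "\<forall>u\<in>V. \<forall>v\<in>V. E u v \<longleftrightarrow> E' (g u) (g v)"
    then have iff: "E u v \<longleftrightarrow> E' (g u) (g v)" if "u \<in> V" "v \<in> V" for u v
      using that by blast
    have stable_iff: "S \<in> stable_sets E V \<longleftrightarrow> g ` S \<in> stable_sets E' V'" if "S \<subseteq> V" for S
    proof -
      have "(\<forall>u\<in>S. \<forall>v\<in>S. \<not> E u v) \<longleftrightarrow> (\<forall>u\<in>S. \<forall>v\<in>S. \<not> E' (g u) (g v))"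
        by (intro ball_cong refl) (use iff that in \<open>simp add: subset_iff\<close>)
      moreover have "g ` S \<subseteq> V'" using that img by blast
      ultimately show ?thesis using that by (simp add: stable_sets_def)
    qed
    show "(\<lambda>S. g ` S) ` stable_sets E V = stable_sets E' V'"
    proof (intro equalityI subsetI)
      fix T assume T: "T \<in> stable_sets E' V'"
      then have "T \<subseteq> g ` V" using img by (simp add: stable_sets_def)
      then obtain S where "S \<subseteq> V" "T = g ` S" by (auto simp: subset_image_iff)
      then show "T \<in> (\<lambda>S. g ` S) ` stable_sets E V" using stable_iff T by blast
    next
      fix T assume "T \<in> (\<lambda>S. g ` S) ` stable_sets E V"
      then obtain S where S: "S \<in> stable_sets E V" "T = g ` S" by blast
      then have "S \<subseteq> V" by (simp add: stable_sets_def)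
      then show "T \<in> stable_sets E' V'" using stable_iff S by blast
    qed
  }
qed

lemma isomorphic_cycle_iff:
  assumes n: "n \<ge> 3"
  shows "complex_isomorphic (stable_sets E V) (independence_complex (cycle_graph n)) \<longleftrightarrow>
         (\<exists>f. cycle_labelling V n f)"
proof -
  define C where "C i j \<longleftrightarrow> {i, j} \<in> snd (cycle_graph n)" for i j
  have C_iff: "C i j \<longleftrightarrow> j = Suc i mod n \<or> i = Suc j mod n" if "i < n" "j < n" for i j
    using that by (auto simp: C_def cycle_graph_def doubleton_eq_iff)
  have C_irrefl: "\<not> C i i" if "i \<in> {..<n}" for i
  proof -
    have "i \<noteq> Suc i mod n" using that n by (cases "Suc i = n") auto
    then show ?thesis using C_iff that by simp
  qed
  have C_sym: "C j i" if "C i j" for i j using that by (simp add: C_def insert_commute)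
  have I: "independence_complex (cycle_graph n) = stable_sets C {..<n}"
    unfolding independence_complex_def independent_set_def stable_sets_def C_def
    by (simp add: cycle_graph_def)
  have "{i} \<in> stable_sets C {..<n}" if "i < n" for i
    using that C_irrefl by (simp add: stable_sets_def)
  then have verts: "complex_verts (stable_sets C {..<n}) = {..<n}"
    by (auto simp: complex_verts_def stable_sets_def)
  have "complex_isomorphic (stable_sets E V) (stable_sets C {..<n}) \<longleftrightarrow>
      (\<exists>g. bij_betw g V {..<n} \<and> (\<forall>u\<in>V. \<forall>v\<in>V. E u v \<longleftrightarrow> C (g u) (g v)))"
    unfolding complex_isomorphic_def complex_verts_stable_sets verts
    by (intro ex_cong1 conj_cong refl stable_sets_image_iff[where E' = C, OF _ C_irrefl C_sym])
  also have "\<dots> \<longleftrightarrow> (\<exists>f. cycle_labelling V n f)"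
  proof
    assume "\<exists>g. bij_betw g V {..<n} \<and> (\<forall>u\<in>V. \<forall>v\<in>V. E u v \<longleftrightarrow> C (g u) (g v))"
    then obtain g where g: "bij_betw g V {..<n}" and
      iff: "\<And>u v. u \<in> V \<Longrightarrow> v \<in> V \<Longrightarrow> E u v \<longleftrightarrow> C (g u) (g v)" by blast
    have inv: "inv_into V g i \<in> V" "g (inv_into V g i) = i" if "i < n" for i
      using that g by (auto simp: bij_betw_def inv_into_into f_inv_into_f)
    have "cycle_labelling V n (inv_into V g)"
      unfolding cycle_labelling_def
      using bij_betw_inv_into[OF g] by (simp add: iff inv C_iff)
    then show "\<exists>f. cycle_labelling V n f" by (rule exI[of _ "inv_into V g"])
  next
    assume "\<exists>f. cycle_labelling V n f"
    then obtain f where f: "bij_betw f {..<n} V" and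
      iff: "\<And>i j. i < n \<Longrightarrow> j < n \<Longrightarrow> E (f i) (f j) \<longleftrightarrow> C i j"
      by (auto simp: cycle_labelling_def C_iff)
    let ?g = "inv_into {..<n} f"
    have inv: "?g v < n" "f (?g v) = v" if "v \<in> V" for v
      using that f inv_into_into[of v f "{..<n}"] by (auto simp: bij_betw_def f_inv_into_f)
    have "E u v \<longleftrightarrow> C (?g u) (?g v)" if "u \<in> V" "v \<in> V" for u v
      using iff[OF inv(1)[OF that(1)] inv(1)[OF that(2)]] inv(2) that by simp
    then show "\<exists>g. bij_betw g V {..<n} \<and> (\<forall>u\<in>V. \<forall>v\<in>V. E u v \<longleftrightarrow> C (g u) (g v))"
      using bij_betw_inv_into[OF f] by blast
  qed
  finally show ?thesis unfolding I .
qed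

lemma obstruction_iff_cycle:
  assumes "finite V"
  shows "(\<not> shellable (stable_sets E V) \<and> (\<forall>W\<subset>V. shellable (stable_sets E W))) \<longleftrightarrow>
         (\<exists>n f. (n = 4 \<or> n \<ge> 6) \<and> cycle_labelling V n f)"
proof
  assume V: "\<not> shellable (stable_sets E V) \<and> (\<forall>W\<subset>V. shellable (stable_sets E W))"
  have no_shed: "\<not> shedding V v" for v
  proof
    assume shed: "shedding V v"
    then have "v \<in> V" by (simp add: shedding_def)
    then have "V - {v} \<subset> V" "V - {v} - {u. E v u} \<subset> V" by blast+
    then show False using shellable_shedding[OF assms shed] V by blast
  qed
  have "\<exists>u\<in>V. \<exists>v\<in>V. E u v"
  proof (rule ccontr)
    assume "\<not> ?thesis"
    then have "\<not> E u v" if "u \<in> V" "v \<in> V" for u v using that by blast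
    then have "shellable (stable_sets E V)" using assms by (intro shellable_edgeless)
    then show False using V by simp
  qed
  then obtain u v where uv: "u \<in> V" "v \<in> V" "E u v" by blast
  have "\<exists>U n f. U \<subseteq> V \<and> cycle_labelling U n f \<and> \<not> (n < 6 \<and> n \<noteq> 4)"
  proof (rule ccontr)
    assume "\<not> ?thesis"
    then have "n < 6 \<and> n \<noteq> 4" if "U \<subseteq> V" "cycle_labelling U n f" for U n f
      using that by blast
    then show False using shedding_exists[OF assms uv] no_shed by blast
  qed
  then obtain U n f where U: "U \<subseteq> V" and f: "cycle_labelling U n f" and "\<not> (n < 6 \<and> n \<noteq> 4)"
    by blast
  then have n: "n = 4 \<or> n \<ge> 6" by linarith
  \<comment> \<open>Minimality: an induced cycle on a proper subset would be a smaller non-shellable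
    induced subcomplex.\<close>
  have "\<not> U \<subset> V" using cycle_not_shellable[OF f n] V by blast
  then have "U = V" using U by blast
  then show "\<exists>n f. (n = 4 \<or> n \<ge> 6) \<and> cycle_labelling V n f" using f n by blast
next
  assume "\<exists>n f. (n = 4 \<or> n \<ge> 6) \<and> cycle_labelling V n f"
  then obtain n f where n: "n = 4 \<or> n \<ge> 6" and f: "cycle_labelling V n f" by blast
  have "n \<ge> 3" using n by linarith
  show "\<not> shellable (stable_sets E V) \<and> (\<forall>W\<subset>V. shellable (stable_sets E W))"
    using cycle_not_shellable[OF f n]
      shellable_proper_subset_cycle[OF int_cycle_of_labelling[OF f \<open>n \<ge> 3\<close>] assms] by blast
qed

end

theorem theorem5p2:
  fixes \<Delta> :: "'a set set"
  assumes "flag_complex \<Delta>"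
  shows "obstruction_to_shellability \<Delta> \<longleftrightarrow>
           (\<exists>n::nat. (n = 4 \<or> n \<ge> 6) \<and>
              complex_isomorphic \<Delta> (independence_complex (cycle_graph n)))"
proof -
  define V where "V = complex_verts \<Delta>"
  \<comment> \<open>No clause \<open>u \<noteq> v\<close> is included: singletons of vertices are
    faces, which already makes \<open>E\<close> irreflexive.\<close>
  define E where "E u v \<longleftrightarrow> u \<in> V \<and> v \<in> V \<and> {u, v} \<notin> \<Delta>" for u v
  have ac: "abstract_complex \<Delta>"
    and flag: "\<And>S. S \<subseteq> V \<Longrightarrow> (\<And>u v. u \<in> S \<Longrightarrow> v \<in> S \<Longrightarrow> u \<noteq> v \<Longrightarrow> {u, v} \<in> \<Delta>) \<Longrightarrow> S \<in> \<Delta>"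
    using assms by (auto simp: flag_complex_def V_def)
  have down: "G \<in> \<Delta>" if "F \<in> \<Delta>" "G \<subseteq> F" for F G
    using ac that unfolding abstract_complex_def by blast
  have fin: "finite V"
    using ac by (auto simp: V_def complex_verts_def abstract_complex_def)
  have single: "{v} \<in> \<Delta>" if "v \<in> V" for v
    using that down by (auto simp: V_def complex_verts_def)
  interpret simple_graph E
  proof
    show "E v u" if "E u v" for u v using that by (simp add: E_def insert_commute)
    show "\<not> E u u" for u using single[of u] by (simp add: E_def)
  qed
  have \<Delta>: "\<Delta> = stable_sets E V"
  proof (intro equalityI subsetI)
    fix F assume F: "F \<in> \<Delta>"
    have "{u, v} \<in> \<Delta>" if "u \<in> F" "v \<in> F" for u v
      using down[OF F] that by simp
    moreover have "F \<subseteq> V" using F by (auto simp: V_def complex_verts_def)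
    ultimately show "F \<in> stable_sets E V" by (auto simp: stable_sets_def E_def)
  next
    fix S assume S: "S \<in> stable_sets E V"
    then have "S \<subseteq> V" by (simp add: stable_sets_def)
    moreover have "{u, v} \<in> \<Delta>" if "u \<in> S" "v \<in> S" for u v
      using S that \<open>S \<subseteq> V\<close> unfolding stable_sets_def E_def by blast
    ultimately show "S \<in> \<Delta>" by (rule flag)
  qed
  have induced: "induced_subcomplex \<Delta> W = stable_sets E W" if "W \<subset> V" for W
    using that unfolding \<Delta> induced_subcomplex_def stable_sets_def by blast
  then have "(\<forall>W\<subset>V. shellable (induced_subcomplex \<Delta> W)) \<longleftrightarrow> (\<forall>W\<subset>V. shellable (stable_sets E W))"
    by simp
  then have "obstruction_to_shellability \<Delta> \<longleftrightarrow>
      \<not> shellable (stable_sets E V) \<and> (\<forall>W\<subset>V. shellable (stable_sets E W))"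
    using ac unfolding obstruction_to_shellability_def V_def[symmetric] \<Delta>[symmetric] by blast
  also have "\<dots> \<longleftrightarrow> (\<exists>n f. (n = 4 \<or> n \<ge> 6) \<and> cycle_labelling V n f)"
    by (rule obstruction_iff_cycle[OF fin])
  also have "\<dots> \<longleftrightarrow> (\<exists>n::nat. (n = 4 \<or> n \<ge> 6) \<and>
      complex_isomorphic \<Delta> (independence_complex (cycle_graph n)))"
  proof -
    have "complex_isomorphic \<Delta> (independence_complex (cycle_graph n)) \<longleftrightarrow>
        (\<exists>f. cycle_labelling V n f)" if "n = 4 \<or> n \<ge> 6" for n
      unfolding \<Delta> by (rule isomorphic_cycle_iff) (use that in linarith)
    then show ?thesis by blast
  qed
  finally show ?thesis .
qed

end
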